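(* Let $\alpha$ be a probability distribution on $[d]$ with $\alpha_1\ge\cdots\ge\alpha_d$, $n\ge1$, $k\in[d]$, and $\lambda\sim\mathrm{SW}^n(\alpha)$. Then \[ \mathbb E\Big[\sum_{i=1}^k\big(\lambda_i/n-\alpha_i\big)^2\Big]\le\frac{46k}{n}. \]
   Context: $\mathrm{SW}^n(\alpha)$ is the law of the RSK shape $\mathrm{shRSK}(\boldsymbol w)$ (Young diagram $\lambda_1\ge\cdots\ge\lambda_d\ge0$ whose first $k$ rows sum to the maximum total length of $k$ disjoint weakly increasing subsequences of $\boldsymbol w$), where $\boldsymbol w\in[d]^n$ has i.i.d. letters with law $\alpha$. *)

theory Defs
  imports Complex_Main
begin

definition words :: "nat \<Rightarrow> nat \<Rightarrow> nat list set" where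
  "words d n = {w. length w = n \<and> set w \<subseteq> {1..d}}"

definition word_prob :: "(nat \<Rightarrow> real) \<Rightarrow> nat list \<Rightarrow> real" where
  "word_prob \<alpha> w = (\<Prod>i<length w. \<alpha> (w ! i))"

definition weakly_incr_on :: "nat list \<Rightarrow> nat set \<Rightarrow> bool" where
  "weakly_incr_on w S \<longleftrightarrow> S \<subseteq> {..<length w} \<and>
     (\<forall>i\<in>S. \<forall>j\<in>S. i < j \<longrightarrow> w ! i \<le> w ! j)"

definition greene :: "nat list \<Rightarrow> nat \<Rightarrow> nat" where
  "greene w k = Max {(\<Sum>j<k. card (F j)) | F.
      (\<forall>j<k. weakly_incr_on w (F j)) \<and>
      (\<forall>i<k. \<forall>j<k. i \<noteq> j \<longrightarrow> F i \<inter> F j = {})}"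

text \<open>Row i (1-based) of the RSK shape shRSK(w): lambda_1 + ... + lambda_k = greene w k.\<close>
definition shRSK :: "nat list \<Rightarrow> nat \<Rightarrow> nat" where
  "shRSK w i = greene w i - greene w (i - 1)"

end

theory Submission
  imports Defs
begin

text \<open>
  Every row satisfies \<open>E (\<lambda>_k - n \<alpha>_k)^2 \<le> 13 n\<close>. Changing one letter changes each Greene number
  by at most one, so the variance of \<open>\<lambda>_k\<close> is at most \<open>4 n\<close>. For the bias, \<open>\<lambda>_k\<close> is squeezed between
  a first-passage quantity (the least number of letters collected by a path reading the letters
  \<open>k, k - 1, ..., 1\<close> one after the other) and a last-passage quantity (the longest increasing
  subsequence in the letters \<open>k, ..., d\<close>). In both, the letters of the path are removed one at a
  time by passing the word through a queue with geometric stationary law. Burke's theorem says that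
  the output word has the law of the input word, so each removal costs only a mean queue length.
  Choosing the source rate at distance \<open>1 / sqrt n\<close> from \<open>\<alpha>_k\<close> makes the total cost \<open>O(sqrt n)\<close>.
\<close>

section \<open>Expectations over random words\<close>

text \<open>The mean of \<open>f\<close> over words of \<open>n\<close> independent letters of law
  \<open>p\<close> on \<open>A\<close>. The recursion suits induction on \<open>n\<close>, and the
  free alphabet leaves room for a source letter or for marks.\<close>

primrec word_exp :: "'a set \<Rightarrow> ('a \<Rightarrow> real) \<Rightarrow> nat \<Rightarrow> ('a list \<Rightarrow> real) \<Rightarrow> real" where
  "word_exp A p 0 f = f []"
| "word_exp A p (Suc n) f = (\<Sum>z\<in>A. p z * word_exp A p n (\<lambda>w. f (z # w)))"

lemma word_exp_add:
  "word_exp A p n (\<lambda>w. f w + g w) = word_exp A p n f + word_exp A p n g"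
  by (induction n arbitrary: f g) (simp_all add: sum.distrib distrib_left)

lemma word_exp_cmult: "word_exp A p n (\<lambda>w. c * f w) = c * word_exp A p n f"
  by (induction n arbitrary: f) (simp_all add: sum_distrib_left mult.left_commute)

lemma word_exp_diff:
  "word_exp A p n (\<lambda>w. f w - g w) = word_exp A p n f - word_exp A p n g"
  by (induction n arbitrary: f g) (simp_all add: sum_subtractf right_diff_distrib)

lemma word_exp_const:
  assumes "sum p A = 1"
  shows "word_exp A p n (\<lambda>w. c) = c"
  using assms by (induction n) (simp_all flip: sum_distrib_right)

lemma word_exp_mono:
  assumes "\<And>a. a \<in> A \<Longrightarrow> 0 \<le> p a"
    and "\<And>w. length w = n \<Longrightarrow> set w \<subseteq> A \<Longrightarrow> f w \<le> g w"
  shows "word_exp A p n f \<le> word_exp A p n g"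
  using assms(2)
proof (induction n arbitrary: f g)
  case (Suc n)
  have "word_exp A p n (\<lambda>w. f (z # w)) \<le> word_exp A p n (\<lambda>w. g (z # w))" if "z \<in> A" for z
    by (rule Suc.IH) (use Suc.prems that in auto)
  then show ?case
    by (auto intro!: sum_mono mult_left_mono assms(1))
qed simp

lemma word_exp_sum_list:
  assumes "sum p A = 1"
  shows "word_exp A p n (\<lambda>w. \<Sum>x\<leftarrow>w. h x) = real n * (\<Sum>a\<in>A. p a * h a)"
proof (induction n)
  case (Suc n)
  have "word_exp A p (Suc n) (\<lambda>w. \<Sum>x\<leftarrow>w. h x)
      = (\<Sum>z\<in>A. p z * h z + p z * (real n * (\<Sum>a\<in>A. p a * h a)))"
    by (simp add: word_exp_add word_exp_const[OF assms] Suc distrib_left)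
  also have "\<dots> = (\<Sum>a\<in>A. p a * h a) + real n * (\<Sum>a\<in>A. p a * h a)"
    by (simp add: sum.distrib assms flip: sum_distrib_right)
  finally show ?case
    by (simp add: distrib_right)
qed simp

text \<open>The hypothesis says, through test functions \<open>h\<close>, that \<open>p'\<close> is
  the image of \<open>p\<close> under \<open>\<phi>\<close>; relabelling letter by letter carries
  this over to words.\<close>

lemma word_exp_map:
  assumes "\<And>h. (\<Sum>a\<in>A. p a * h (\<phi> a)) = (\<Sum>b\<in>B. p' b * h b)"
  shows "word_exp A p n (\<lambda>w. f (map \<phi> w)) = word_exp B p' n f"
proof (induction n arbitrary: f)
  case (Suc n)
  have "word_exp A p n (\<lambda>w. f (\<phi> z # map \<phi> w)) = word_exp B p' n (\<lambda>w. f (\<phi> z # w))" for z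
    by (rule Suc.IH)
  then show ?case
    using assms[of "\<lambda>z. word_exp B p' n (\<lambda>w. f (z # w))"] by simp
qed simp

lemma words_Suc: "words d (Suc n) = (\<lambda>(z, w). z # w) ` ({1..d} \<times> words d n)"
  by (auto simp: words_def length_Suc_conv image_iff)

lemma word_prob_Cons: "word_prob \<alpha> (z # w) = \<alpha> z * word_prob \<alpha> w"
  unfolding word_prob_def length_Cons prod.lessThan_Suc_shift by simp

lemma sum_words_eq_word_exp:
  "(\<Sum>w\<in>words d n. word_prob \<alpha> w * f w) = word_exp {1..d} \<alpha> n f"
proof (induction n arbitrary: f)
  case 0
  have "words d 0 = {[]}" by (auto simp: words_def)
  then show ?case by (simp add: word_prob_def)
next
  case (Suc n)
  have "inj_on (\<lambda>(z, w). z # w) ({1..d} \<times> words d n)"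
    by (auto simp: inj_on_def)
  then have "(\<Sum>w\<in>words d (Suc n). word_prob \<alpha> w * f w)
      = (\<Sum>(z, w)\<in>{1..d} \<times> words d n. word_prob \<alpha> (z # w) * f (z # w))"
    by (simp add: words_Suc sum.reindex case_prod_unfold o_def)
  also have "\<dots> = (\<Sum>z\<in>{1..d}. \<alpha> z * (\<Sum>w\<in>words d n. word_prob \<alpha> w * f (z # w)))"
    by (simp add: sum.cartesian_product[symmetric] word_prob_Cons sum_distrib_left mult.assoc)
  finally show ?case
    by (simp add: Suc)
qed

text \<open>The left side is the variance of \<open>g\<close>; the mean squared deviation from
  \<open>m\<close> exceeds it by the square of the mean of \<open>g\<close> minus
  \<open>m\<close>.\<close>

lemma weighted_square_of_mean_le:
  fixes p g :: "'a \<Rightarrow> real"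
  assumes "sum p A = 1"
  shows "(\<Sum>z\<in>A. p z * (g z)\<^sup>2) - (\<Sum>z\<in>A. p z * g z)\<^sup>2 \<le> (\<Sum>z\<in>A. p z * (g z - m)\<^sup>2)"
proof -
  let ?M = "\<Sum>z\<in>A. p z * g z"
  have "(\<Sum>z\<in>A. p z * (g z - m)\<^sup>2)
      = (\<Sum>z\<in>A. p z * (g z)\<^sup>2 - 2 * m * (p z * g z) + m\<^sup>2 * p z)"
    by (intro sum.cong) (auto simp: power2_eq_square algebra_simps)
  also have "\<dots> = (\<Sum>z\<in>A. p z * (g z)\<^sup>2) - 2 * m * ?M + m\<^sup>2"
    by (simp add: sum.distrib sum_subtractf assms flip: sum_distrib_left)
  finally show ?thesis
    using zero_le_power2[of "?M - m"] by (simp add: power2_eq_square algebra_simps)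
qed

text \<open>Martingale form of the Efron--Stein inequality: exposing one letter at a time.\<close>
lemma word_exp_variance_le:
  assumes p: "\<And>a. a \<in> A \<Longrightarrow> 0 \<le> p a" "sum p A = 1"
    and lip: "\<And>u z z' v. \<bar>f (u @ z # v) - f (u @ z' # v)\<bar> \<le> c"
  shows "word_exp A p n (\<lambda>w. (f w)\<^sup>2) - (word_exp A p n f)\<^sup>2 \<le> c\<^sup>2 * real n"
  using lip
proof (induction n arbitrary: f)
  case (Suc n)
  \<comment> \<open>\<open>g z\<close> is the conditional mean given the first letter
    \<open>z\<close>. The variance is the mean conditional variance, bounded by induction, plus the
    variance of \<open>g\<close>, bounded by deviations from one value \<open>g a\<close>.\<close>
  define g where "g z = word_exp A p n (\<lambda>w. f (z # w))" for z
  obtain a where "a \<in> A" using p(2) by fastforce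
  have IH: "word_exp A p n (\<lambda>w. (f (z # w))\<^sup>2) - (g z)\<^sup>2 \<le> c\<^sup>2 * real n" for z
    unfolding g_def by (rule Suc.IH) (use Suc.prems[of "z # _"] in simp)
  have g_le: "g z - g z' \<le> c" for z z'
  proof -
    have "g z \<le> word_exp A p n (\<lambda>w. f (z' # w) + c)"
      unfolding g_def using p(1)
    proof (rule word_exp_mono)
      fix w show "f (z # w) \<le> f (z' # w) + c"
        using Suc.prems[of "[]" z w z'] by simp
    qed
    then show ?thesis
      by (simp add: word_exp_add word_exp_const[OF p(2)] g_def)
  qed
  have sq: "(g z - g a)\<^sup>2 \<le> c\<^sup>2" for z
    using g_le[of z a] g_le[of a z] by (intro abs_le_square_iff[THEN iffD1]) linarith
  have "(\<Sum>z\<in>A. p z * (g z - g a)\<^sup>2) \<le> (\<Sum>z\<in>A. p z * c\<^sup>2)"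
    using sq p(1) by (intro sum_mono mult_left_mono) auto
  then have between: "(\<Sum>z\<in>A. p z * (g z)\<^sup>2) - (\<Sum>z\<in>A. p z * g z)\<^sup>2 \<le> c\<^sup>2"
    using weighted_square_of_mean_le[OF p(2), of g "g a"]
    by (simp add: p(2) flip: sum_distrib_right)
  have "(\<Sum>z\<in>A. p z * word_exp A p n (\<lambda>w. (f (z # w))\<^sup>2))
      \<le> (\<Sum>z\<in>A. p z * ((g z)\<^sup>2 + c\<^sup>2 * real n))"
    using IH p(1) by (intro sum_mono mult_left_mono) (auto simp: algebra_simps)
  also have "\<dots> = (\<Sum>z\<in>A. p z * (g z)\<^sup>2) + c\<^sup>2 * real n"
    by (simp add: distrib_left sum.distrib p(2) flip: sum_distrib_right)
  finally show ?case
    using between by (simp add: g_def algebra_simps)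
qed simp

section \<open>Stationary queues\<close>

text \<open>A letter \<open>x\<close> is an arrival and is output as the inert letter \<open>y\<close>; a letter \<open>y\<close> is a service
  and is output as a departure \<open>x\<close>, unless the queue is empty.\<close>
fun queue :: "'a \<Rightarrow> 'a \<Rightarrow> nat \<Rightarrow> 'a list \<Rightarrow> 'a list" where
  "queue x y q [] = []"
| "queue x y q (z # w) =
    (if z = x then y # queue x y (Suc q) w
     else if z = y then (case q of 0 \<Rightarrow> y # queue x y 0 w | Suc q' \<Rightarrow> x # queue x y q' w)
     else z # queue x y q w)"

text \<open>Burke's theorem. One step of the queue, sending the pair (queue length, input letter) to
  (new queue length, output letter), is an involution up to the order of the components:
  (q, x) goes to (q + 1, y), (q + 1, y) goes to (q, x), and (0, y) is fixed. It preserves the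
  weights \<open>\<rho> ^ q * p z\<close>.\<close>
lemma queue_stationary:
  assumes "finite A" "x \<in> A" "y \<in> A" "x \<noteq> y" "p x = \<rho> * p y" "\<bar>\<rho>\<bar> < 1"
  shows "(\<lambda>q. \<rho> ^ q * word_exp A p n (\<lambda>w. f (queue x y q w))) sums (word_exp A p n f / (1 - \<rho>))"
proof (induction n arbitrary: f)
  case 0
  then show ?case
    using sums_mult2[OF geometric_sums[of \<rho>], of "f []"] assms(6) by simp
next
  case (Suc n)
  define a where "a z q = \<rho> ^ q * word_exp A p n (\<lambda>w. f (z # queue x y q w))" for z q
  define e where "e z = word_exp A p n (\<lambda>w. f (z # w)) / (1 - \<rho>)" for z
  \<comment> \<open>\<open>b q\<close> collects the input \<open>y\<close>: with an empty queue it
    stays \<open>y\<close>, otherwise it becomes a departure \<open>x\<close>, and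
    \<open>\<rho> * p y = p x\<close> rewrites the weight. The input \<open>x\<close> gives
    \<open>p y * a y (Suc q)\<close>. The boundary terms \<open>p y * a y 0\<close> cancel in the
    sum over \<open>q\<close>.\<close>
  define b where "b q = (case q of 0 \<Rightarrow> p y * a y 0 | Suc q' \<Rightarrow> p x * a x q')" for q
  have a: "a z sums e z" for z
    unfolding a_def e_def by (rule Suc.IH)
  have A: "A = insert x (insert y (A - {x, y}))"
    using assms by auto
  have sumA: "(\<Sum>z\<in>A. g z) = g x + g y + (\<Sum>z\<in>A - {x, y}. g z)" for g :: "'a \<Rightarrow> real"
    by (subst A) (use assms in simp)
  have "b sums (p x * e x + p y * a y 0)"
    using sums_mult[OF a[of x], of "p x"] sums_Suc_iff[of b "p x * e x"] by (simp add: b_def)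
  then have sums: "(\<lambda>q. p y * a y (Suc q) + b q + (\<Sum>z\<in>A - {x, y}. p z * a z q))
      sums (p y * (e y - a y 0) + (p x * e x + p y * a y 0) + (\<Sum>z\<in>A - {x, y}. p z * e z))"
    by (intro sums_add sums_mult sums_sum a) (simp_all add: sums_Suc_iff a)
  have total: "p y * (e y - a y 0) + (p x * e x + p y * a y 0) + (\<Sum>z\<in>A - {x, y}. p z * e z)
      = word_exp A p (Suc n) f / (1 - \<rho>)"
    by (simp add: e_def sumA add_divide_distrib sum_divide_distrib algebra_simps)
  have "\<rho> ^ q * word_exp A p (Suc n) (\<lambda>w. f (queue x y q w))
      = p y * a y (Suc q) + b q + (\<Sum>z\<in>A - {x, y}. p z * a z q)" for q
  proof -
    have "(\<Sum>z\<in>A - {x, y}. p z * word_exp A p n (\<lambda>w. f (queue x y q (z # w)))) * \<rho> ^ q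
        = (\<Sum>z\<in>A - {x, y}. p z * a z q)"
      by (auto simp: a_def sum_distrib_left mult_ac intro!: sum.cong)
    then show ?thesis
      using assms(4,5) by (cases q) (simp_all add: sumA a_def b_def algebra_simps)
  qed
  with sums total show ?case
    by simp
qed

lemma sums_geometric_mean:
  fixes \<rho> :: real
  assumes "\<bar>\<rho>\<bar> < 1"
  shows "(\<lambda>q. \<rho> ^ q * real q) sums (\<rho> / (1 - \<rho>)\<^sup>2)"
proof -
  have "(\<lambda>q. real (Suc q) * \<rho> ^ q - \<rho> ^ q) sums (1 / (1 - \<rho>)\<^sup>2 - 1 / (1 - \<rho>))"
    using assms geometric_deriv_sums[of \<rho>] by (intro sums_diff geometric_sums) auto
  moreover have "1 / (1 - \<rho>)\<^sup>2 - 1 / (1 - \<rho>) = \<rho> / (1 - \<rho>)\<^sup>2"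
    using assms by (simp add: divide_simps power2_eq_square)
  ultimately show ?thesis
    by (simp add: algebra_simps)
qed

text \<open>Averaging a bound that loses at most the initial queue length \<open>q\<close> over the stationary
  (geometric) law of \<open>q\<close> costs the mean queue length.\<close>
lemma word_exp_queue_le:
  assumes A: "finite A" "x \<in> A" "y \<in> A" "x \<noteq> y"
    and p: "\<And>a. a \<in> A \<Longrightarrow> 0 \<le> p a" "sum p A = 1" "p x < p y"
    and le: "\<And>q w. g w \<le> f (queue x y q w) + real q"
  shows "word_exp A p n g \<le> word_exp A p n f + p x / (p y - p x)"
proof -
  define \<rho> where "\<rho> = p x / p y"
  have py: "0 < p y" "0 \<le> p x"
    using p(1)[OF A(2)] p(3) by auto
  have \<rho>: "0 \<le> \<rho>" "\<rho> < 1" "p x = \<rho> * p y"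
    using py p(3) by (auto simp: \<rho>_def)
  have "(\<lambda>q. \<rho> ^ q * word_exp A p n g) sums (1 / (1 - \<rho>) * word_exp A p n g)"
    using \<rho> by (intro sums_mult2 geometric_sums) auto
  moreover have "(\<lambda>q. \<rho> ^ q * word_exp A p n (\<lambda>w. f (queue x y q w)) + \<rho> ^ q * real q)
      sums (word_exp A p n f / (1 - \<rho>) + \<rho> / (1 - \<rho>)\<^sup>2)"
    using A \<rho> by (intro sums_add queue_stationary sums_geometric_mean) auto
  moreover have "\<rho> ^ q * word_exp A p n g
      \<le> \<rho> ^ q * word_exp A p n (\<lambda>w. f (queue x y q w)) + \<rho> ^ q * real q" for q
  proof -
    have "word_exp A p n g \<le> word_exp A p n (\<lambda>w. f (queue x y q w) + real q)"
      using p(1) le by (rule word_exp_mono)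
    also have "\<dots> = word_exp A p n (\<lambda>w. f (queue x y q w)) + real q"
      by (simp add: word_exp_add word_exp_const[OF p(2)])
    finally show ?thesis
      using \<rho>(1) by (simp add: mult_left_mono flip: distrib_left)
  qed
  ultimately have "1 / (1 - \<rho>) * word_exp A p n g \<le> word_exp A p n f / (1 - \<rho>) + \<rho> / (1 - \<rho>)\<^sup>2"
    by (rule sums_le[rotated])
  \<comment> \<open>The factor \<open>1 - \<rho>\<close> normalises the weights
    \<open>\<rho> ^ q\<close> to a probability law with mean
    \<open>\<rho> / (1 - \<rho>)\<close>.\<close>
  then have "(1 - \<rho>) * (1 / (1 - \<rho>) * word_exp A p n g)
      \<le> (1 - \<rho>) * (word_exp A p n f / (1 - \<rho>) + \<rho> / (1 - \<rho>)\<^sup>2)"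
    using \<rho>(2) by (intro mult_left_mono) auto
  then have "word_exp A p n g \<le> word_exp A p n f + \<rho> / (1 - \<rho>)"
    using \<rho>(2) by (simp add: distrib_left power2_eq_square)
  moreover have "\<rho> / (1 - \<rho>) = p x / (p y - p x)"
    using py p(3) by (simp add: \<rho>_def divide_simps)
  ultimately show ?thesis
    by simp
qed

section \<open>Counting letters before and after a queue\<close>

lemma queue_append: "\<exists>q'. queue x y q (u @ v) = queue x y q u @ queue x y q' v"
proof (induction u arbitrary: q)
  case Nil
  then show ?case by auto
next
  case (Cons z u)
  show ?case
    using Cons[of "Suc q"] Cons[of q] Cons[of "q - 1"] by (auto split: nat.split)
qed

text \<open>Customers are conserved. A departure \<open>x\<close> belongs to an arrival or to one of
  the \<open>q\<close> initial customers, and it uses up one service \<open>y\<close>; every arrival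
  is output as \<open>y\<close>, and so is every service that finds the queue empty. This gives this
  bound and the next three.\<close>

lemma count_queue_le_arrival:
  assumes "x \<noteq> y"
  shows "count_list (queue x y q w) x \<le> count_list w x + q"
proof (induction w arbitrary: q)
  case (Cons z w)
  show ?case
    using Cons[of "Suc q"] Cons[of q] Cons[of "q - 1"] assms by (auto split: nat.split)
qed simp

lemma count_service_le_queue:
  assumes "x \<noteq> y"
  shows "count_list w y \<le> count_list (queue x y q w) y + q"
proof (induction w arbitrary: q)
  case (Cons z w)
  show ?case
    using Cons[of "Suc q"] Cons[of q] Cons[of "q - 1"] assms by (auto split: nat.split)
qed simp

lemma count_queue_le_service:
  assumes "x \<noteq> y"
  shows "count_list (queue x y q w) x \<le> count_list w y"
proof (induction w arbitrary: q)
  case (Cons z w)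
  show ?case
    using Cons[of "Suc q"] Cons[of q] Cons[of "q - 1"] assms by (auto split: nat.split)
qed simp

lemma count_arrival_le_queue:
  assumes "x \<noteq> y"
  shows "count_list w x \<le> count_list (queue x y q w) y"
proof (induction w arbitrary: q)
  case (Cons z w)
  show ?case
    using Cons[of "Suc q"] Cons[of q] Cons[of "q - 1"] assms by (auto split: nat.split)
qed simp

section \<open>Passage numbers\<close>

text \<open>\<open>max_pass l ls w\<close> is the largest number of letters collected by a path that reads \<open>w\<close>
  and switches at times of its choice from letter \<open>l\<close> to the successive letters of \<open>ls\<close>;
  \<open>min_pass l ls w\<close> is the smallest number when the path has to visit all of \<open>ls\<close>.\<close>
fun max_pass :: "'a \<Rightarrow> 'a list \<Rightarrow> 'a list \<Rightarrow> nat" where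
  "max_pass l [] w = count_list w l"
| "max_pass l (l' # ls) [] = 0"
| "max_pass l (l' # ls) (z # w) =
    max (max_pass l' ls (z # w)) ((if z = l then 1 else 0) + max_pass l (l' # ls) w)"

fun min_pass :: "'a \<Rightarrow> 'a list \<Rightarrow> 'a list \<Rightarrow> nat" where
  "min_pass l [] w = count_list w l"
| "min_pass l (l' # ls) [] = 0"
| "min_pass l (l' # ls) (z # w) =
    min (min_pass l' ls (z # w)) ((if z = l then 1 else 0) + min_pass l (l' # ls) w)"

lemma max_pass_Nil [simp]: "max_pass l ls [] = 0"
  by (cases ls) auto

lemma min_pass_Nil [simp]: "min_pass l ls [] = 0"
  by (cases ls) auto

lemma max_pass_append_ge: "count_list u l + max_pass l' ls v \<le> max_pass l (l' # ls) (u @ v)"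
proof (induction u)
  case Nil
  then show ?case by (cases v) auto
qed auto

lemma min_pass_append_le: "min_pass l (l' # ls) (u @ v) \<le> count_list u l + min_pass l' ls v"
proof (induction u)
  case Nil
  then show ?case by (cases v) auto
qed auto

lemma min_pass_Cons_le: "min_pass l ls (z # w) \<le> (if z = l then 1 else 0) + min_pass l ls w"
  by (cases ls) auto

lemma min_pass_le_count: "min_pass l ls w \<le> count_list w l"
  \<comment> \<open>The path stays on \<open>l\<close> to the end and visits all of
    \<open>ls\<close> on the empty remainder, at no cost.\<close>
  using min_pass_append_le[of l _ _ w "[]"] by (cases ls) auto

lemma max_pass_split:
  "\<exists>u v. w = u @ v \<and> max_pass l (l' # ls) w = count_list u l + max_pass l' ls v"
proof (induction w)
  case (Cons z w)
  then obtain u v where uv: "w = u @ v" "max_pass l (l' # ls) w = count_list u l + max_pass l' ls v"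
    by blast
  show ?case
  proof (cases "max_pass l (l' # ls) (z # w) = max_pass l' ls (z # w)")
    case True
    then show ?thesis by (intro exI[of _ "[]"] exI[of _ "z # w"]) simp
  next
    case False
    then have "max_pass l (l' # ls) (z # w) = count_list (z # u) l + max_pass l' ls v"
      using uv by (auto simp: max_def split: if_splits)
    then show ?thesis using uv(1) by (metis append_Cons)
  qed
qed simp

lemma min_pass_split:
  "\<exists>u v. w = u @ v \<and> min_pass l (l' # ls) w = count_list u l + min_pass l' ls v"
proof (induction w)
  case (Cons z w)
  then obtain u v where uv: "w = u @ v" "min_pass l (l' # ls) w = count_list u l + min_pass l' ls v"
    by blast
  show ?case
  proof (cases "min_pass l (l' # ls) (z # w) = min_pass l' ls (z # w)")
    case True
    then show ?thesis by (intro exI[of _ "[]"] exI[of _ "z # w"]) simp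
  next
    case False
    then have "min_pass l (l' # ls) (z # w) = count_list (z # u) l + min_pass l' ls v"
      using uv by (auto simp: min_def split: if_splits)
    then show ?thesis using uv(1) by (metis append_Cons)
  qed
qed simp

section \<open>Effect of a queue on passage numbers\<close>

lemma count_queue_other: "l \<noteq> x \<Longrightarrow> l \<noteq> y \<Longrightarrow> count_list (queue x y q w) l = count_list w l"
  by (induction x y q w rule: queue.induct) (auto split: nat.split)

lemma max_pass_queue_other:
  "x \<notin> set (l # ls) \<Longrightarrow> y \<notin> set (l # ls) \<Longrightarrow> max_pass l ls (queue x y q w) = max_pass l ls w"
proof (induction l ls w arbitrary: q rule: max_pass.induct)
  case (1 l w)
  then show ?case by (auto intro!: count_queue_other)
next
  case (3 l l' ls z w)
  have 1: "max_pass l' ls (queue x y q (z # w)) = max_pass l' ls (z # w)" for q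
    using 3 by auto
  have 2: "max_pass l (l' # ls) (queue x y q w) = max_pass l (l' # ls) w" for q
    using 3 by auto
  show ?case
    using 1[of q] 3(3,4) by (auto simp: 2 split: nat.splits)
qed simp

lemma min_pass_queue_other:
  "x \<notin> set (l # ls) \<Longrightarrow> y \<notin> set (l # ls) \<Longrightarrow> min_pass l ls (queue x y q w) = min_pass l ls w"
proof (induction l ls w arbitrary: q rule: min_pass.induct)
  case (1 l w)
  then show ?case by (auto intro!: count_queue_other)
next
  case (3 l l' ls z w)
  have 1: "min_pass l' ls (queue x y q (z # w)) = min_pass l' ls (z # w)" for q
    using 3 by auto
  have 2: "min_pass l (l' # ls) (queue x y q w) = min_pass l (l' # ls) w" for q
    using 3 by auto
  show ?case
    using 1[of q] 3(3,4) by (auto simp: 2 split: nat.splits)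
qed simp

text \<open>Arrivals are \<open>j\<close>, services are \<open>a\<close>. Where the path reads
  \<open>a\<close>, the output has at most \<open>q\<close> fewer letters \<open>a\<close>; where it
  reads \<open>j\<close>, every \<open>j\<close> is output as \<open>a\<close>. So one segment on
  \<open>a\<close> replaces both.\<close>

lemma max_pass_queue:
  assumes "a \<noteq> j" "a \<notin> set ls" "j \<notin> set ls"
  shows "max_pass a (j # ls) w \<le> max_pass a ls (queue j a q w) + q"
proof -
  obtain u v where uv: "w = u @ v" "max_pass a (j # ls) w = count_list u a + max_pass j ls v"
    using max_pass_split by metis
  have *: "count_list u a + count_list v j \<le> count_list (queue j a q (u @ v)) a + q" for v
  proof -
    obtain q' where "queue j a q (u @ v) = queue j a q u @ queue j a q' v"
      using queue_append by metis
    then show ?thesis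
      using count_service_le_queue[of j a u q] count_arrival_le_queue[of j a v q'] assms(1) by auto
  qed
  show ?thesis
  proof (cases ls)
    case Nil
    then show ?thesis using uv * by auto
  next
    case (Cons l' ls')
    obtain v1 v2 where v: "v = v1 @ v2" "max_pass j ls v = count_list v1 j + max_pass l' ls' v2"
      using max_pass_split Cons by metis
    obtain q' where q': "queue j a q ((u @ v1) @ v2) = queue j a q (u @ v1) @ queue j a q' v2"
      using queue_append by metis
    have "max_pass l' ls' (queue j a q' v2) = max_pass l' ls' v2"
      using assms Cons by (intro max_pass_queue_other) auto
    then show ?thesis
      using max_pass_append_ge[of "queue j a q (u @ v1)" a l' ls' "queue j a q' v2"] *[of v1]
        uv v q' Cons by auto
  qed
qed

text \<open>The roles are exchanged: \<open>a\<close> arrives and \<open>j\<close> serves.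
  Departures \<open>a\<close> number at most the arrivals plus \<open>q\<close> where the path reads
  \<open>a\<close>, and at most the services where it reads \<open>j\<close>.\<close>

lemma min_pass_queue:
  assumes "a \<noteq> j" "a \<notin> set ls" "j \<notin> set ls"
  shows "min_pass a ls (queue a j q w) \<le> min_pass a (j # ls) w + q"
proof -
  obtain u v where uv: "w = u @ v" "min_pass a (j # ls) w = count_list u a + min_pass j ls v"
    using min_pass_split by metis
  have *: "count_list (queue a j q (u @ v)) a \<le> count_list u a + count_list v j + q" for v
  proof -
    obtain q' where "queue a j q (u @ v) = queue a j q u @ queue a j q' v"
      using queue_append by metis
    then show ?thesis
      using count_queue_le_arrival[of a j q u] count_queue_le_service[of a j q' v] assms(1) by auto
  qed
  show ?thesis
  proof (cases ls)
    case Nil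
    then show ?thesis using uv * by auto
  next
    case (Cons l' ls')
    obtain v1 v2 where v: "v = v1 @ v2" "min_pass j ls v = count_list v1 j + min_pass l' ls' v2"
      using min_pass_split Cons by metis
    obtain q' where q': "queue a j q ((u @ v1) @ v2) = queue a j q (u @ v1) @ queue a j q' v2"
      using queue_append by metis
    have "min_pass l' ls' (queue a j q' v2) = min_pass l' ls' v2"
      using assms Cons by (intro min_pass_queue_other) auto
    then show ?thesis
      using min_pass_append_le[of a l' ls' "queue a j q (u @ v1)" "queue a j q' v2"] *[of v1]
        uv v q' Cons by auto
  qed
qed

section \<open>Mean passage numbers for a source separated from the other letters\<close>

lemma word_exp_count:
  assumes "finite A" "sum p A = 1" "a \<in> A"
  shows "word_exp A p n (\<lambda>w. real (count_list w a)) = real n * p a"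
proof -
  have "real (count_list w a) = (\<Sum>x\<leftarrow>w. of_bool (x = a))" for w :: "'a list"
    by (induction w) auto
  then show ?thesis
    using assms by (simp add: word_exp_sum_list)
qed

text \<open>Queues absorb the letters of \<open>ls\<close> in turn. The word keeps its law, so each
  costs only the mean queue length \<open>p j / (p a - p j)\<close>, until the count of
  \<open>a\<close> is left.\<close>

lemma word_exp_max_pass_le:
  assumes "finite A" "a \<in> A" "set ls \<subseteq> A" "distinct (a # ls)"
    and "\<And>z. z \<in> A \<Longrightarrow> 0 \<le> p z" "sum p A = 1" "\<And>j. j \<in> set ls \<Longrightarrow> p j < p a"
  shows "word_exp A p n (\<lambda>w. real (max_pass a ls w))
    \<le> real n * p a + (\<Sum>j\<leftarrow>ls. p j / (p a - p j))"
  using assms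
proof (induction ls)
  case Nil
  then show ?case by (simp add: word_exp_count)
next
  case (Cons j ls)
  have "word_exp A p n (\<lambda>w. real (max_pass a (j # ls) w))
      \<le> word_exp A p n (\<lambda>w. real (max_pass a ls w)) + p j / (p a - p j)"
  proof (rule word_exp_queue_le)
    show "real (max_pass a (j # ls) w) \<le> real (max_pass a ls (queue j a q w)) + real q" for q w
      using max_pass_queue[of a j ls w q] Cons.prems(4) by simp
  qed (use Cons.prems in auto)
  then show ?case
    using Cons by simp
qed

lemma word_exp_min_pass_ge:
  assumes "finite A" "a \<in> A" "set ls \<subseteq> A" "distinct (a # ls)"
    and "\<And>z. z \<in> A \<Longrightarrow> 0 \<le> p z" "sum p A = 1" "\<And>j. j \<in> set ls \<Longrightarrow> p a < p j"
  shows "real n * p a - (\<Sum>j\<leftarrow>ls. p a / (p j - p a))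
    \<le> word_exp A p n (\<lambda>w. real (min_pass a ls w))"
  using assms
proof (induction ls)
  case Nil
  then show ?case by (simp add: word_exp_count)
next
  case (Cons j ls)
  \<comment> \<open>Signs are reversed because the queue lemma bounds means from above only.\<close>
  have "word_exp A p n (\<lambda>w. - real (min_pass a (j # ls) w))
      \<le> word_exp A p n (\<lambda>w. - real (min_pass a ls w)) + p a / (p j - p a)"
  proof (rule word_exp_queue_le)
    show "- real (min_pass a (j # ls) w) \<le> - real (min_pass a ls (queue a j q w)) + real q" for q w
      using min_pass_queue[of a j ls q w] Cons.prems(4) by simp
  qed (use Cons.prems in auto)
  then show ?case
    using Cons word_exp_cmult[of A p n "-1"] by simp
qed

section \<open>Comparison of words with altered letters\<close>

lemma count_list_map_le:
  assumes "\<And>z. z \<in> set w \<Longrightarrow> fst z = l \<Longrightarrow> \<phi> z = l' \<or> snd z"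
  shows "count_list (map fst w) l \<le> count_list (map \<phi> w) l' + count_list (map snd w) True"
  using assms
proof (induction w)
  case (Cons z w)
  then show ?case using Cons.prems[of z] Cons.IH by (force split: if_splits)
qed simp

text \<open>The optimal path for \<open>map fst w\<close> keeps its switching times in
  \<open>map \<phi> w\<close>; a collected letter is lost only if it is marked.\<close>

lemma max_pass_map_le:
  assumes "\<And>z j. z \<in> set w \<Longrightarrow> j \<in> set (l # ls) \<Longrightarrow> fst z = j \<Longrightarrow> \<phi> z = \<sigma> j \<or> snd z"
  shows "max_pass l ls (map fst w)
    \<le> max_pass (\<sigma> l) (map \<sigma> ls) (map \<phi> w) + count_list (map snd w) True"
  using assms
proof (induction ls arbitrary: l w)
  case Nil
  then show ?case by (auto intro!: count_list_map_le)
next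
  case (Cons l' ls)
  obtain u v where uv: "map fst w = u @ v"
    and eq: "max_pass l (l' # ls) (map fst w) = count_list u l + max_pass l' ls v"
    using max_pass_split by metis
  then obtain u' v' where w: "w = u' @ v'" "u = map fst u'" "v = map fst v'"
    by (auto simp: map_eq_append_conv)
  have "count_list u l \<le> count_list (map \<phi> u') (\<sigma> l) + count_list (map snd u') True"
    unfolding w(2) by (rule count_list_map_le) (use Cons.prems w(1) in auto)
  moreover have "max_pass l' ls v
      \<le> max_pass (\<sigma> l') (map \<sigma> ls) (map \<phi> v') + count_list (map snd v') True"
    unfolding w(3) by (rule Cons.IH) (use Cons.prems w(1) in auto)
  moreover have "count_list (map \<phi> u') (\<sigma> l) + max_pass (\<sigma> l') (map \<sigma> ls) (map \<phi> v')
      \<le> max_pass (\<sigma> l) (map \<sigma> (l' # ls)) (map \<phi> w)"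
    using max_pass_append_ge by (simp add: w(1))
  ultimately show ?case
    using eq w(1) by simp
qed

lemma count_list_map_ge:
  assumes "\<And>z. z \<in> set w \<Longrightarrow> \<phi> z = l' \<Longrightarrow> \<psi> z = l"
  shows "count_list (map \<phi> w) l' \<le> count_list (map \<psi> w) l"
  using assms by (induction w) auto

text \<open>The optimal path for \<open>map \<psi> w\<close> keeps its switching times in
  \<open>map \<phi> w\<close>, where it collects nothing new.\<close>

lemma min_pass_map_ge:
  assumes "\<And>z j. z \<in> set w \<Longrightarrow> j \<in> set (l # ls) \<Longrightarrow> \<phi> z = \<sigma> j \<Longrightarrow> \<psi> z = j"
  shows "min_pass (\<sigma> l) (map \<sigma> ls) (map \<phi> w) \<le> min_pass l ls (map \<psi> w)"
  using assms
proof (induction ls arbitrary: l w)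
  case Nil
  then show ?case by (auto intro!: count_list_map_ge)
next
  case (Cons l' ls)
  obtain u v where uv: "map \<psi> w = u @ v"
    and eq: "min_pass l (l' # ls) (map \<psi> w) = count_list u l + min_pass l' ls v"
    using min_pass_split by metis
  then obtain u' v' where w: "w = u' @ v'" "u = map \<psi> u'" "v = map \<psi> v'"
    by (auto simp: map_eq_append_conv)
  have "count_list (map \<phi> u') (\<sigma> l) \<le> count_list u l"
    unfolding w(2) by (rule count_list_map_ge) (use Cons.prems w(1) in auto)
  moreover have "min_pass (\<sigma> l') (map \<sigma> ls) (map \<phi> v') \<le> min_pass l' ls v"
    unfolding w(3) by (rule Cons.IH) (use Cons.prems w(1) in auto)
  moreover have "min_pass (\<sigma> l) (map \<sigma> (l' # ls)) (map \<phi> w)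
      \<le> count_list (map \<phi> u') (\<sigma> l) + min_pass (\<sigma> l') (map \<sigma> ls) (map \<phi> v')"
    using min_pass_append_le by (simp add: w(1))
  ultimately show ?case
    using eq by simp
qed

text \<open>Each letter independently carries a mark with probability \<open>r\<close>.\<close>
definition mark :: "('a \<Rightarrow> real) \<Rightarrow> real \<Rightarrow> 'a \<times> bool \<Rightarrow> real" where
  "mark p r = (\<lambda>(z, b). p z * (if b then r else 1 - r))"

lemma sum_mark:
  fixes p :: "'a \<Rightarrow> real"
  shows "(\<Sum>a\<in>A \<times> UNIV. mark p r a * h a)
    = (\<Sum>z\<in>A. p z * (r * h (z, True) + (1 - r) * h (z, False)))"
proof -
  have "(\<Sum>a\<in>A \<times> UNIV. mark p r a * h a) = (\<Sum>z\<in>A. \<Sum>b\<in>UNIV. mark p r (z, b) * h (z, b))"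
    by (simp add: sum.cartesian_product case_prod_unfold)
  then show ?thesis
    by (simp add: UNIV_bool mark_def algebra_simps)
qed

lemma word_exp_map_fst:
  "word_exp (A \<times> UNIV) (mark p r) n (\<lambda>w. f (map fst w)) = word_exp A p n f"
  by (rule word_exp_map) (subst sum_mark, simp add: algebra_simps)

lemma sum_atMost_insert_zero:
  fixes g :: "nat \<Rightarrow> real"
  shows "(\<Sum>z\<in>{0..d}. g z) = g 0 + (\<Sum>z\<in>{1..d}. g z)"
proof -
  have "{0..d} = insert 0 {1..d}" by auto
  then show ?thesis by simp
qed

text \<open>Overwriting the marked letters, and all letters \<open>k\<close>, by the source letter \<open>0\<close> makes the source
  rate exceed the rate of every later letter by at least \<open>r\<close>.\<close>
lemma max_pass_mean_le:
  fixes \<alpha> :: "nat \<Rightarrow> real"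
  assumes nonneg: "\<And>i. i \<in> {1..d} \<Longrightarrow> \<alpha> i \<ge> 0"
    and sum1: "(\<Sum>i=1..d. \<alpha> i) = 1"
    and anti: "\<And>i j. 1 \<le> i \<Longrightarrow> i \<le> j \<Longrightarrow> j \<le> d \<Longrightarrow> \<alpha> j \<le> \<alpha> i"
    and k: "1 \<le> k" "k \<le> d" and r: "0 < r" "r \<le> 1"
  shows "word_exp {1..d} \<alpha> n (\<lambda>w. real (max_pass k [Suc k..<Suc d] w))
    \<le> real n * \<alpha> k + 2 * r * real n + 1 / r"
proof -
  define ls where "ls = [Suc k..<Suc d]"
  define \<phi> :: "nat \<times> bool \<Rightarrow> nat" where "\<phi> = (\<lambda>(z, b). if b \<or> z = k then 0 else z)"
  define \<sigma> where "\<sigma> j = (if j = k then 0 else j)" for j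
  \<comment> \<open>The law of \<open>\<phi>\<close>: the source \<open>0\<close> absorbs all marked
    letters and the unmarked letters \<open>k\<close>, so \<open>k\<close> itself no longer
    occurs.\<close>
  define p where "p b = (if b = 0 then r + (1 - r) * \<alpha> k else if b = k then 0 else (1 - r) * \<alpha> b)" for b
  let ?A = "{1..d} \<times> (UNIV :: bool set)"
  have map_ls: "map \<sigma> ls = ls"
    by (intro map_idI) (auto simp: \<sigma>_def ls_def)
  have push: "(\<Sum>a\<in>?A. mark \<alpha> r a * h (\<phi> a)) = (\<Sum>b\<in>{0..d}. p b * h b)" for h
  proof -
    have "(\<Sum>a\<in>?A. mark \<alpha> r a * h (\<phi> a))
        = (\<Sum>z=1..d. r * h 0 * \<alpha> z + (1 - r) * (\<alpha> z * h (\<sigma> z)))"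
      by (auto simp: sum_mark \<phi>_def \<sigma>_def algebra_simps intro!: sum.cong)
    also have "\<dots> = r * h 0 + (1 - r) * (\<Sum>z=1..d. \<alpha> z * h (\<sigma> z))"
      using sum1 by (simp add: sum.distrib flip: sum_distrib_left)
    also have "(\<Sum>z=1..d. \<alpha> z * h (\<sigma> z)) = \<alpha> k * h 0 + (\<Sum>z\<in>{1..d} - {k}. \<alpha> z * h z)"
      using k sum.remove[of "{1..d}" k "\<lambda>z. \<alpha> z * h (\<sigma> z)"] by (simp add: \<sigma>_def)
    also have "r * h 0 + (1 - r) * (\<alpha> k * h 0 + (\<Sum>z\<in>{1..d} - {k}. \<alpha> z * h z))
        = p 0 * h 0 + (\<Sum>z\<in>{1..d} - {k}. p z * h z)"
      by (auto simp: p_def algebra_simps sum_distrib_left intro!: sum.cong)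
    also have "(\<Sum>z\<in>{1..d} - {k}. p z * h z) = (\<Sum>z=1..d. p z * h z)"
      using k sum.remove[of "{1..d}" k "\<lambda>z. p z * h z"] by (simp add: p_def[of k])
    finally show ?thesis
      by (simp only: sum_atMost_insert_zero)
  qed
  have sum_mark1: "sum (mark \<alpha> r) ?A = 1"
    using sum_mark[of \<alpha> r "\<lambda>_. 1" "{1..d}"] sum1 by simp
  have sum_p: "sum p {0..d} = 1"
    using push[of "\<lambda>_. 1"] sum_mark1 by simp
  have p_nonneg: "0 \<le> p z" if "z \<in> {0..d}" for z
    using that nonneg k r by (auto simp: p_def)
  have p0: "p 0 = r + (1 - r) * \<alpha> k"
    by (simp add: p_def)
  have gap: "r \<le> p 0 - p j" "p j \<le> \<alpha> j" "0 \<le> p j" if "j \<in> set ls" for j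
  proof -
    have j: "k < j" "j \<le> d"
      using that by (auto simp: ls_def)
    then have "(1 - r) * \<alpha> j \<le> (1 - r) * \<alpha> k"
      using anti[of k j] k r by (intro mult_left_mono) auto
    then show "r \<le> p 0 - p j"
      using j by (simp add: p_def)
    show "p j \<le> \<alpha> j"
      using j nonneg[of j] r by (simp add: p_def mult_left_le_one_le)
    show "0 \<le> p j" using j p_nonneg by simp
  qed
  have "word_exp {1..d} \<alpha> n (\<lambda>w. real (max_pass k ls w))
      = word_exp ?A (mark \<alpha> r) n (\<lambda>w. real (max_pass k ls (map fst w)))"
    by (rule word_exp_map_fst[symmetric])
  also have "\<dots> \<le> word_exp ?A (mark \<alpha> r) n
      (\<lambda>w. real (max_pass 0 ls (map \<phi> w)) + real (count_list (map snd w) True))"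
  proof (rule word_exp_mono)
    fix w :: "(nat \<times> bool) list"
    have "max_pass k ls (map fst w)
        \<le> max_pass (\<sigma> k) (map \<sigma> ls) (map \<phi> w) + count_list (map snd w) True"
      by (rule max_pass_map_le) (auto simp: \<phi>_def \<sigma>_def)
    then show "real (max_pass k ls (map fst w))
        \<le> real (max_pass 0 ls (map \<phi> w)) + real (count_list (map snd w) True)"
      by (simp add: map_ls \<sigma>_def)
  qed (use r nonneg in \<open>auto simp: mark_def\<close>)
  also have "\<dots> = word_exp {0..d} p n (\<lambda>w. real (max_pass 0 ls w))
      + word_exp ?A (mark \<alpha> r) n (\<lambda>w. real (count_list (map snd w) True))"
    using word_exp_map[OF push, of n "\<lambda>w. real (max_pass 0 ls w)"] by (simp add: word_exp_add)
  also have "word_exp ?A (mark \<alpha> r) n (\<lambda>w. real (count_list (map snd w) True)) = r * real n"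
  proof -
    have "real (count_list (map snd w) True) = (\<Sum>x\<leftarrow>w. of_bool (snd x))" for w :: "(nat \<times> bool) list"
      by (induction w) auto
    then show ?thesis
      using sum_mark[of \<alpha> r "\<lambda>x. of_bool (snd x)" "{1..d}"] sum1
        word_exp_sum_list[OF sum_mark1, of n "\<lambda>x. of_bool (snd x)"]
      by (simp flip: sum_distrib_right)
  qed
  also have "word_exp {0..d} p n (\<lambda>w. real (max_pass 0 ls w))
      \<le> real n * p 0 + (\<Sum>j\<leftarrow>ls. p j / (p 0 - p j))"
  proof (rule word_exp_max_pass_le)
    show "set ls \<subseteq> {0..d}" "distinct (0 # ls)"
      by (auto simp: ls_def)
    show "p j < p 0" if "j \<in> set ls" for j
      using gap(1)[OF that] r by linarith
  qed (use p_nonneg sum_p in simp_all)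
  \<comment> \<open>The numerators are at most \<open>\<alpha> j\<close> and sum to at most 1, so
    the gap \<open>r\<close> bounds all removals together by \<open>1 / r\<close>, whatever
    \<open>d\<close> is.\<close>
  also have "(\<Sum>j\<leftarrow>ls. p j / (p 0 - p j)) \<le> (\<Sum>j\<leftarrow>ls. \<alpha> j / r)"
    using gap r order_trans[OF gap(3) gap(2)] by (intro sum_list_mono frac_le) auto
  also have "(\<Sum>j\<leftarrow>ls. \<alpha> j / r) = (\<Sum>j\<in>{Suc k..d}. \<alpha> j) / r"
    by (simp add: ls_def sum_list_distinct_conv_sum_set sum_divide_distrib atLeastLessThanSuc_atLeastAtMost del: upt_Suc)
  also have "(\<Sum>j\<in>{Suc k..d}. \<alpha> j) / r \<le> 1 / r"
    using nonneg r by (intro divide_right_mono) (auto simp: sum1[symmetric] intro!: sum_mono2)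
  \<comment> \<open>The second share of \<open>r * real n\<close>: beside the marked letters counted
    in the comparison, the source rate exceeds \<open>\<alpha> k\<close> by at most
    \<open>r\<close>.\<close>
  also have "real n * p 0 \<le> real n * (\<alpha> k + r)"
    using nonneg[of k] k r by (intro mult_left_mono) (auto simp: p0 algebra_simps)
  finally show ?thesis
    by (simp add: ls_def algebra_simps)
qed

text \<open>Here the source \<open>0\<close> is a thinning of the letters \<open>k\<close>, with rate \<open>\<alpha> k - r\<close>.\<close>
lemma min_pass_mean_ge:
  fixes \<alpha> :: "nat \<Rightarrow> real"
  assumes nonneg: "\<And>i. i \<in> {1..d} \<Longrightarrow> \<alpha> i \<ge> 0"
    and sum1: "(\<Sum>i=1..d. \<alpha> i) = 1"
    and anti: "\<And>i j. 1 \<le> i \<Longrightarrow> i \<le> j \<Longrightarrow> j \<le> d \<Longrightarrow> \<alpha> j \<le> \<alpha> i"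
    and k: "1 \<le> k" "k \<le> d" and r: "0 < r"
  shows "real n * \<alpha> k - r * real n - 1 / r
    \<le> word_exp {1..d} \<alpha> n (\<lambda>w. real (min_pass k (rev [1..<k]) w))"
proof (cases "\<alpha> k \<le> r")
  \<comment> \<open>No source of positive rate \<open>\<alpha> k - r\<close> is available, but the
    left side is then negative.\<close>
  case True
  have "real n * \<alpha> k \<le> real n * r"
    using True by (intro mult_left_mono) auto
  moreover have "0 \<le> word_exp {1..d} \<alpha> n (\<lambda>w. real (min_pass k (rev [1..<k]) w))"
    using word_exp_mono[of "{1..d}" \<alpha> n "\<lambda>_. 0"] nonneg word_exp_const[OF sum1] by auto
  moreover have "0 \<le> 1 / r"
    using r by simp
  ultimately show ?thesis
    by (simp only: mult.commute[of r])
next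
  case False
  define ls where "ls = rev [1..<k]"
  \<comment> \<open>A letter \<open>k\<close> becomes a source with probability \<open>t\<close>,
    hence at rate \<open>\<alpha> k - r\<close>; the other letters \<open>k\<close> keep rate
    \<open>r\<close> and are never read by the path.\<close>
  define t where "t = (\<alpha> k - r) / \<alpha> k"
  define \<phi> :: "nat \<times> bool \<Rightarrow> nat" where "\<phi> = (\<lambda>(z, b). if b \<and> z = k then 0 else z)"
  define \<sigma> where "\<sigma> j = (if j = k then 0 else j)" for j
  define p where "p b = (if b = 0 then \<alpha> k - r else if b = k then r else \<alpha> b)" for b
  let ?A = "{1..d} \<times> (UNIV :: bool set)"
  have t: "0 \<le> t" "t \<le> 1" "\<alpha> k * t = \<alpha> k - r"
    using False r by (auto simp: t_def)
  have map_ls: "map \<sigma> ls = ls"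
    by (intro map_idI) (auto simp: \<sigma>_def ls_def)
  have push: "(\<Sum>a\<in>?A. mark \<alpha> t a * h (\<phi> a)) = (\<Sum>b\<in>{0..d}. p b * h b)" for h
  proof -
    have "(\<Sum>a\<in>?A. mark \<alpha> t a * h (\<phi> a))
        = (\<Sum>z=1..d. \<alpha> z * (t * h (if z = k then 0 else z) + (1 - t) * h z))"
      by (simp add: sum_mark \<phi>_def)
    also have "\<dots> = \<alpha> k * (t * h 0 + (1 - t) * h k) + (\<Sum>z\<in>{1..d} - {k}. \<alpha> z * h z)"
      by (subst sum.remove[of _ k]) (use k in \<open>auto simp: algebra_simps intro!: sum.cong\<close>)
    also have "\<alpha> k * (t * h 0 + (1 - t) * h k) = (\<alpha> k * t) * h 0 + (\<alpha> k - \<alpha> k * t) * h k"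
      by (simp add: algebra_simps)
    also have "\<dots> = p 0 * h 0 + p k * h k"
      using k by (simp add: t(3) p_def)
    also have "(\<Sum>z\<in>{1..d} - {k}. \<alpha> z * h z) = (\<Sum>z\<in>{1..d} - {k}. p z * h z)"
      by (auto simp: p_def intro!: sum.cong)
    finally show ?thesis
      using k sum.remove[of "{1..d}" k "\<lambda>z. p z * h z"] by (simp add: sum_atMost_insert_zero)
  qed
  have sum_p: "sum p {0..d} = 1"
    using push[of "\<lambda>_. 1"] sum_mark[of \<alpha> t "\<lambda>_. 1" "{1..d}"] sum1 by simp
  have p_nonneg: "0 \<le> p z" if "z \<in> {0..d}" for z
    using that nonneg k r False by (auto simp: p_def)
  have p0: "p 0 = \<alpha> k - r"
    by (simp add: p_def)
  have gap: "r \<le> p j - p 0" if "j \<in> set ls" for j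
    using that anti[of j k] k by (auto simp: p_def ls_def)
  have "(\<Sum>j\<leftarrow>ls. p 0 / (p j - p 0)) \<le> (\<Sum>j\<leftarrow>ls. \<alpha> j / r)"
  proof (intro sum_list_mono frac_le)
    fix j assume "j \<in> set ls"
    then show "p 0 \<le> \<alpha> j" "0 \<le> \<alpha> j"
      using anti[of j k] nonneg[of j] k r by (auto simp: p0 ls_def)
  qed (use gap r in auto)
  also have "\<dots> = (\<Sum>j\<in>{1..<k}. \<alpha> j) / r"
    by (simp add: ls_def sum_list_distinct_conv_sum_set sum_divide_distrib flip: rev_map)
  also have "\<dots> \<le> 1 / r"
    using nonneg r k by (intro divide_right_mono) (auto simp: sum1[symmetric] intro!: sum_mono2)
  finally have "real n * \<alpha> k - r * real n - 1 / r \<le> real n * p 0 - (\<Sum>j\<leftarrow>ls. p 0 / (p j - p 0))"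
    by (simp add: p0 algebra_simps)
  also have "\<dots> \<le> word_exp {0..d} p n (\<lambda>w. real (min_pass 0 ls w))"
  proof (rule word_exp_min_pass_ge)
    show "set ls \<subseteq> {0..d}" "distinct (0 # ls)"
      using k by (auto simp: ls_def)
    show "p 0 < p j" if "j \<in> set ls" for j
      using gap[OF that] r by linarith
  qed (use p_nonneg sum_p in simp_all)
  also have "\<dots> = word_exp ?A (mark \<alpha> t) n (\<lambda>w. real (min_pass 0 ls (map \<phi> w)))"
    by (rule word_exp_map[OF push, symmetric])
  also have "\<dots> \<le> word_exp ?A (mark \<alpha> t) n (\<lambda>w. real (min_pass k ls (map fst w)))"
  proof (rule word_exp_mono)
    fix w :: "(nat \<times> bool) list" assume w: "set w \<subseteq> ?A"
    have "min_pass (\<sigma> k) (map \<sigma> ls) (map \<phi> w) \<le> min_pass k ls (map fst w)"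
      by (rule min_pass_map_ge) (use w in \<open>auto simp: \<phi>_def \<sigma>_def ls_def split: if_splits\<close>)
    then show "real (min_pass 0 ls (map \<phi> w)) \<le> real (min_pass k ls (map fst w))"
      by (simp add: map_ls \<sigma>_def)
  qed (use t nonneg in \<open>auto simp: mark_def\<close>)
  also have "\<dots> = word_exp {1..d} \<alpha> n (\<lambda>w. real (min_pass k ls w))"
    by (rule word_exp_map_fst)
  finally show ?thesis
    by (simp add: ls_def)
qed

section \<open>Greene numbers\<close>

definition incr_family :: "nat list \<Rightarrow> nat \<Rightarrow> (nat \<Rightarrow> nat set) \<Rightarrow> bool" where
  "incr_family w k F \<longleftrightarrow> (\<forall>j<k. weakly_incr_on w (F j)) \<and>
     (\<forall>i<k. \<forall>j<k. i \<noteq> j \<longrightarrow> F i \<inter> F j = {})"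

lemma greene_eq: "greene w k = Max {(\<Sum>j<k. card (F j)) | F. incr_family w k F}"
  by (simp add: greene_def incr_family_def)

lemma incr_family_subset: "incr_family w k F \<Longrightarrow> (\<Union>j<k. F j) \<subseteq> {..<length w}"
  by (auto simp: incr_family_def weakly_incr_on_def)

lemma incr_family_card:
  assumes "incr_family w k F"
  shows "(\<Sum>j<k. card (F j)) = card (\<Union>j<k. F j)"
proof -
  have "finite (F i)" if "i < k" for i
    using finite_subset[OF incr_family_subset[OF assms]] that by auto
  then show ?thesis
    using card_UN_disjoint[of "{..<k}" F] assms by (simp add: incr_family_def)
qed

lemma finite_family_sums: "finite {(\<Sum>j<k. card (F j)) | F. incr_family w k F}"
proof -
  have "(\<Sum>j<k. card (F j)) \<le> length w" if F: "incr_family w k F" for F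
    using card_mono[OF _ incr_family_subset[OF F]] by (simp add: incr_family_card[OF F])
  then have "{(\<Sum>j<k. card (F j)) | F. incr_family w k F} \<subseteq> {..length w}"
    by auto
  then show ?thesis
    by (rule finite_subset) simp
qed

lemma greene_ge: "incr_family w k F \<Longrightarrow> (\<Sum>j<k. card (F j)) \<le> greene w k"
  unfolding greene_eq by (rule Max_ge[OF finite_family_sums]) auto

lemma greene_attained: "\<exists>F. incr_family w k F \<and> greene w k = (\<Sum>j<k. card (F j))"
proof -
  have "incr_family w k (\<lambda>_. {})"
    by (simp add: incr_family_def weakly_incr_on_def)
  then have "{(\<Sum>j<k. card (F j)) | F. incr_family w k F} \<noteq> {}"
    by blast
  from Max_in[OF finite_family_sums this] show ?thesis
    by (auto simp: greene_eq)
qed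

lemma greene_mono_k: "greene w k \<le> greene w (Suc k)"
proof -
  obtain F where F: "incr_family w k F" "greene w k = (\<Sum>j<k. card (F j))"
    using greene_attained by blast
  have "incr_family w (Suc k) (F(k := {}))"
    using F(1) by (auto simp: incr_family_def weakly_incr_on_def less_Suc_eq)
  from greene_ge[OF this] show ?thesis
    by (simp add: F(2))
qed

text \<open>Deleting the changed position from an optimal family loses at most one element, as the
  sets are disjoint.\<close>

lemma greene_change_letter: "greene (u @ z # v) k \<le> greene (u @ z' # v) k + 1"
proof -
  let ?w = "u @ z # v" and ?w' = "u @ z' # v"
  obtain F where F: "incr_family ?w k F" "greene ?w k = (\<Sum>j<k. card (F j))"
    using greene_attained by blast
  define F' where "F' j = F j - {length u}" for j
  have nth: "?w' ! i = ?w ! i" if "i \<noteq> length u" for i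
    using that by (auto simp: nth_append nth_Cons')
  have "weakly_incr_on ?w' (F' j)" if j: "weakly_incr_on ?w (F j)" for j
    unfolding weakly_incr_on_def
  proof (intro conjI ballI impI)
    show "F' j \<subseteq> {..<length ?w'}"
      using j by (auto simp: weakly_incr_on_def F'_def)
    fix a b assume ab: "a \<in> F' j" "b \<in> F' j" "a < b"
    then have "?w ! a \<le> ?w ! b"
      using j by (simp add: weakly_incr_on_def F'_def)
    then show "?w' ! a \<le> ?w' ! b"
      using ab nth[of a] nth[of b] by (simp add: F'_def)
  qed
  then have "\<forall>j<k. weakly_incr_on ?w' (F' j)"
    using F(1) by (simp add: incr_family_def)
  moreover have "\<forall>i<k. \<forall>j<k. i \<noteq> j \<longrightarrow> F' i \<inter> F' j = {}"
    using F(1) unfolding incr_family_def F'_def by blast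
  ultimately have F': "incr_family ?w' k F'"
    by (simp add: incr_family_def)
  have "(\<Union>j<k. F j) \<subseteq> insert (length u) (\<Union>j<k. F' j)"
    by (auto simp: F'_def)
  then have "card (\<Union>j<k. F j) \<le> card (insert (length u) (\<Union>j<k. F' j))"
    using finite_subset[OF incr_family_subset[OF F']] by (intro card_mono) auto
  also have "\<dots> \<le> card (\<Union>j<k. F' j) + 1"
    by (simp add: card_insert_le_m1 card_insert_if)
  finally have "card (\<Union>j<k. F j) \<le> greene ?w' k + 1"
    using greene_ge[OF F'] incr_family_card[OF F'] by linarith
  then show ?thesis
    by (simp add: F(2) incr_family_card[OF F(1)])
qed

section \<open>Decreasing chains as the dual of increasing families\<close>

definition decr_chain :: "nat list \<Rightarrow> nat list \<Rightarrow> bool" where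
  "decr_chain w xs \<longleftrightarrow> sorted_wrt (\<lambda>i j. i < j \<and> w ! j < w ! i) xs"

lemma decr_chain_Cons:
  "decr_chain w (x # xs) \<longleftrightarrow> (\<forall>y\<in>set xs. x < y \<and> w ! y < w ! x) \<and> decr_chain w xs"
  by (simp add: decr_chain_def)

lemma decr_chain_append:
  "decr_chain w (xs @ ys) \<longleftrightarrow> decr_chain w xs \<and> decr_chain w ys \<and>
     (\<forall>x\<in>set xs. \<forall>y\<in>set ys. x < y \<and> w ! y < w ! x)"
  by (simp add: decr_chain_def sorted_wrt_append)

lemma decr_chain_Nil [simp]: "decr_chain w []"
  by (simp add: decr_chain_def)

lemma decr_chain_distinct: "decr_chain w xs \<Longrightarrow> distinct xs"
  by (induction xs) (auto simp: decr_chain_Cons)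

lemma decr_chain_letters_inj: "decr_chain w xs \<Longrightarrow> inj_on ((!) w) (set xs)"
  by (induction xs) (force simp: decr_chain_Cons)+

lemma decr_chain_length_le:
  assumes "decr_chain w xs" "\<And>x. x \<in> set xs \<Longrightarrow> w ! x \<in> L" "finite L"
  shows "length xs \<le> card L"
proof -
  have "length xs = card ((!) w ` set xs)"
    using assms(1) by (simp add: card_image decr_chain_letters_inj decr_chain_distinct distinct_card)
  also have "\<dots> \<le> card L"
    using assms by (intro card_mono) auto
  finally show ?thesis .
qed

text \<open>An increasing set contains at most one member of a strictly decreasing chain, so
  assigning to each member a set containing it is injective.\<close>

lemma incr_family_decr_chain:
  assumes F: "incr_family w k F" and xs: "decr_chain w xs" "set xs \<subseteq> (\<Union>j<k. F j)"
  shows "length xs \<le> k"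
proof -
  define c where "c x = (SOME j. j < k \<and> x \<in> F j)" for x
  have c: "c x < k \<and> x \<in> F (c x)" if "x \<in> set xs" for x
    unfolding c_def by (rule someI_ex) (use that xs(2) in auto)
  have "inj_on c (set xs)"
  proof (rule inj_onI, rule ccontr)
    fix x y assume xy: "x \<in> set xs" "y \<in> set xs" "c x = c y" "x \<noteq> y"
    obtain i j where ij: "i < length xs" "j < length xs" "x = xs ! i" "y = xs ! j"
      using xy(1,2) by (metis in_set_conv_nth)
    have "x < y \<and> w ! y < w ! x \<or> y < x \<and> w ! x < w ! y"
      using xs(1) ij xy(4) unfolding decr_chain_def sorted_wrt_iff_nth_less
      by (metis nat_neq_iff)
    moreover have "weakly_incr_on w (F (c x))"
      using F c[OF xy(1)] by (auto simp: incr_family_def)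
    moreover have "x \<in> F (c x)" "y \<in> F (c x)"
      using c[OF xy(1)] c[OF xy(2)] xy(3) by auto
    ultimately show False
      unfolding weakly_incr_on_def by (meson leD)
  qed
  then have "card (set xs) \<le> card {..<k}"
    using c by (intro card_inj_on_le[of c]) auto
  then show ?thesis
    using xs(1) by (simp add: decr_chain_distinct distinct_card)
qed

text \<open>Colour each position by the maximal length of a strictly decreasing chain starting there.\<close>
lemma ex_colouring:
  assumes S: "finite S"
    and le: "\<And>xs. decr_chain w xs \<Longrightarrow> set xs \<subseteq> S \<Longrightarrow> length xs \<le> k"
  obtains h where "\<And>i. i \<in> S \<Longrightarrow> h i < k"
    and "\<And>i. i \<in> S \<Longrightarrow> \<exists>xs. decr_chain w (i # xs) \<and> set xs \<subseteq> S \<and> length xs = h i"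
    and "\<And>i j. i \<in> S \<Longrightarrow> j \<in> S \<Longrightarrow> i < j \<Longrightarrow> h i = h j \<Longrightarrow> w ! i \<le> w ! j"
proof -
  \<comment> \<open>\<open>length xs\<close> does not count \<open>i\<close> itself, so colours
    start at 0 and stay below \<open>k\<close>.\<close>
  define L where "L i = {length xs | xs. decr_chain w (i # xs) \<and> set xs \<subseteq> S}" for i
  have L: "L i \<subseteq> {..<k}" if "i \<in> S" for i
    using that le[of "i # _"] by (force simp: L_def)
  then have fin: "finite (L i)" if "i \<in> S" for i
    using that finite_subset by blast
  have ne: "L i \<noteq> {}" for i
    by (auto simp: L_def decr_chain_Cons intro!: exI[of _ "[]"])
  have in_L: "Max (L i) \<in> L i" if "i \<in> S" for i
    using fin ne that by (intro Max_in) auto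
  show ?thesis
  proof (rule that[of "\<lambda>i. Max (L i)"])
    fix i assume "i \<in> S"
    then show "Max (L i) < k"
      using in_L L by blast
    show "\<exists>xs. decr_chain w (i # xs) \<and> set xs \<subseteq> S \<and> length xs = Max (L i)"
      using in_L[OF \<open>i \<in> S\<close>] by (auto simp: L_def)
  next
    fix i j assume ij: "i \<in> S" "j \<in> S" "i < j" "Max (L i) = Max (L j)"
    show "w ! i \<le> w ! j"
    proof (rule ccontr)
      assume "\<not> w ! i \<le> w ! j"
      obtain xs where xs: "decr_chain w (j # xs)" "set xs \<subseteq> S" "length xs = Max (L j)"
        using in_L[OF ij(2)] by (auto simp: L_def)
      then have "decr_chain w (i # j # xs)"
        using ij(3) \<open>\<not> w ! i \<le> w ! j\<close> by (force simp: decr_chain_Cons)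
      then have "Suc (Max (L j)) \<in> L i"
        using xs ij(2) by (auto simp: L_def intro!: exI[of _ "j # xs"])
      then show False
        using Max_ge[OF fin[OF ij(1)]] ij(4) by fastforce
    qed
  qed
qed

lemma colour_classes_incr_family:
  assumes "S \<subseteq> {..<length w}"
    and "\<And>i j. i \<in> S \<Longrightarrow> j \<in> S \<Longrightarrow> i < j \<Longrightarrow> h i = h j \<Longrightarrow> w ! i \<le> w ! j"
  shows "incr_family w k (\<lambda>c. {i\<in>S. h i = c})"
  using assms by (auto simp: incr_family_def weakly_incr_on_def)

text \<open>The colour classes are \<open>k\<close> increasing sets that cover \<open>S\<close>.
  Lower bounds on Greene numbers thus reduce to bounding chains.\<close>

lemma card_le_greene:
  assumes S: "S \<subseteq> {..<length w}"
    and le: "\<And>xs. decr_chain w xs \<Longrightarrow> set xs \<subseteq> S \<Longrightarrow> length xs \<le> k"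
  shows "card S \<le> greene w k"
proof -
  have fin: "finite S" using S by (rule finite_subset) simp
  obtain h where h: "\<And>i. i \<in> S \<Longrightarrow> h i < k"
    "\<And>i j. i \<in> S \<Longrightarrow> j \<in> S \<Longrightarrow> i < j \<Longrightarrow> h i = h j \<Longrightarrow> w ! i \<le> w ! j"
    using ex_colouring[OF fin le] by metis
  have F: "incr_family w k (\<lambda>c. {i\<in>S. h i = c})"
    using S h(2) by (rule colour_classes_incr_family)
  have "S = (\<Union>c<k. {i\<in>S. h i = c})"
    using h(1) by auto
  then show ?thesis
    using greene_ge[OF F] incr_family_card[OF F] by simp
qed

section \<open>Upper bound for a row by a last-passage number\<close>

lemma count_list_drop_take:
  assumes "e \<le> length w"
  shows "count_list (take (e - s) (drop s w)) l = card {p. s \<le> p \<and> p < e \<and> w ! p = l}"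
proof -
  let ?v = "take (e - s) (drop s w)"
  have "count_list ?v l = card {i. i < length ?v \<and> l = ?v ! i}"
    by (simp add: count_list_eq_length_filter length_filter_conv_card)
  also have "\<dots> = card ((+) s ` {i. i < length ?v \<and> l = ?v ! i})"
    by (simp add: card_image)
  also have "(+) s ` {i. i < length ?v \<and> l = ?v ! i} = {p. s \<le> p \<and> p < e \<and> w ! p = l}"
  proof safe
    fix p assume p: "s \<le> p" "p < e" "l = w ! p"
    then show "p \<in> (+) s ` {i. i < length ?v \<and> w ! p = ?v ! i}"
      using assms by (intro image_eqI[of _ _ "p - s"]) auto
  qed (use assms in auto)
  finally show ?thesis .
qed

lemma drop_split: "s \<le> e \<Longrightarrow> drop s w = take (e - s) (drop s w) @ drop e w"
  by (metis append_take_drop_id drop_drop le_add_diff_inverse2)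

text \<open>An increasing set meets its letters in blocks \<open>l\<close>, \<open>l + 1\<close>,
  and so on; a path that leaves each letter after its last occurrence in \<open>T\<close> collects
  them all.\<close>

lemma card_incr_le_max_pass:
  assumes "T \<subseteq> {s..<length w}" "weakly_incr_on w T" "\<And>i. i \<in> T \<Longrightarrow> l \<le> w ! i \<and> w ! i \<le> l + m"
    and "s \<le> length w"
  shows "card T \<le> max_pass l [Suc l..<Suc (l + m)] (drop s w)"
  using assms
proof (induction m arbitrary: l s T)
  case 0
  have "T \<subseteq> {p. s \<le> p \<and> p < length w \<and> w ! p = l}"
    using 0 by fastforce
  then have "card T \<le> card {p. s \<le> p \<and> p < length w \<and> w ! p = l}"
    by (intro card_mono) auto
  then show ?case
    using count_list_drop_take[of "length w" w s l] by simp
next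
  case (Suc m)
  define T1 where "T1 = {i\<in>T. w ! i = l}"
  define T2 where "T2 = {i\<in>T. w ! i \<noteq> l}"
  \<comment> \<open>One past the last \<open>l\<close> in \<open>T\<close>; inserting
    \<open>s\<close> supplies the switching time when \<open>T\<close> contains no
    \<open>l\<close>.\<close>
  define e where "e = Max (insert s (Suc ` T1))"
  have fin: "finite T"
    using Suc.prems(1) by (rule finite_subset) simp
  then have fin1: "finite (insert s (Suc ` T1))" by (simp add: T1_def)
  have e: "s \<le> e" "e \<le> length w" "\<And>i. i \<in> T1 \<Longrightarrow> i < e"
  proof -
    show "s \<le> e" "e \<le> length w"
      using fin1 Suc.prems(1,4) by (auto simp: e_def T1_def)
    show "i < e" if "i \<in> T1" for i
      using Max_ge[OF fin1, of "Suc i"] that by (simp add: e_def Suc_le_eq)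
  qed
  have T2_ge: "e \<le> i" if "i \<in> T2" for i
  proof -
    have "Suc j \<le> i" if "j \<in> T1" for j
    proof (rule ccontr)
      assume "\<not> Suc j \<le> i"
      then have "i < j"
        using \<open>i \<in> T2\<close> \<open>j \<in> T1\<close> by (cases "i = j") (auto simp: T1_def T2_def)
      then have "w ! i \<le> w ! j"
        using Suc.prems(2) \<open>i \<in> T2\<close> \<open>j \<in> T1\<close> by (auto simp: weakly_incr_on_def T1_def T2_def)
      then show False
        using Suc.prems(3) \<open>i \<in> T2\<close> \<open>j \<in> T1\<close> by (fastforce simp: T1_def T2_def)
    qed
    then show ?thesis
      using fin1 Suc.prems(1) that by (auto simp: e_def T2_def)
  qed
  have "card T1 \<le> card {p. s \<le> p \<and> p < e \<and> w ! p = l}"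
    using e(3) Suc.prems(1) by (intro card_mono) (auto simp: T1_def)
  then have c1: "card T1 \<le> count_list (take (e - s) (drop s w)) l"
    using count_list_drop_take[OF e(2)] by simp
  have c2: "card T2 \<le> max_pass (Suc l) [Suc (Suc l)..<Suc (Suc l + m)] (drop e w)"
  proof (rule Suc.IH)
    show "T2 \<subseteq> {e..<length w}"
      using T2_ge Suc.prems(1) by (auto simp: T2_def)
    show "weakly_incr_on w T2"
      using Suc.prems(2) by (auto simp: weakly_incr_on_def T2_def)
    show "Suc l \<le> w ! i \<and> w ! i \<le> Suc l + m" if "i \<in> T2" for i
      using Suc.prems(3)[of i] that by (auto simp: T2_def)
  qed (rule e(2))
  have "[Suc l..<Suc (l + Suc m)] = Suc l # [Suc (Suc l)..<Suc (Suc l + m)]"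
    by (simp add: upt_conv_Cons del: upt_Suc)
  then have "count_list (take (e - s) (drop s w)) l
      + max_pass (Suc l) [Suc (Suc l)..<Suc (Suc l + m)] (drop e w)
      \<le> max_pass l [Suc l..<Suc (l + Suc m)] (drop s w)"
    using max_pass_append_ge[of "take (e - s) (drop s w)" l] drop_split[OF e(1)] by metis
  moreover have "card T = card T1 + card T2"
  proof -
    have "T = T1 \<union> T2" "T1 \<inter> T2 = {}" "finite T1" "finite T2"
      using fin by (auto simp: T1_def T2_def)
    then show ?thesis
      using card_Un_disjoint by blast
  qed
  ultimately show ?case
    using c1 c2 by linarith
qed

text \<open>Recolour an optimal family of \<open>k + 1\<close> sets by chain lengths. The colours
  below \<open>k\<close> form a family of \<open>k\<close> sets. A position of colour
  \<open>k\<close> starts a chain with \<open>k\<close> smaller letters after it, so its letter is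
  at least \<open>k + 1\<close>, and one path collects this increasing class.\<close>

lemma greene_Suc_le_max_pass:
  assumes w: "set w \<subseteq> {1..d}" and k: "Suc k \<le> d"
  shows "greene w (Suc k) \<le> greene w k + max_pass (Suc k) [Suc (Suc k)..<Suc d] w"
proof -
  obtain F where F: "incr_family w (Suc k) F" "greene w (Suc k) = (\<Sum>j<Suc k. card (F j))"
    using greene_attained by blast
  define S where "S = (\<Union>j<Suc k. F j)"
  have S: "S \<subseteq> {..<length w}"
    using incr_family_subset[OF F(1)] by (simp add: S_def)
  then have fin: "finite S" by (rule finite_subset) simp
  have letters: "1 \<le> w ! i \<and> w ! i \<le> d" if "i \<in> S" for i
    using that S w nth_mem[of i w] by fastforce
  have le: "length xs \<le> Suc k" if "decr_chain w xs" "set xs \<subseteq> S" for xs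
    using incr_family_decr_chain[OF F(1) that(1)] that(2) by (simp add: S_def)
  obtain h where h: "\<And>i. i \<in> S \<Longrightarrow> h i < Suc k"
    "\<And>i. i \<in> S \<Longrightarrow> \<exists>xs. decr_chain w (i # xs) \<and> set xs \<subseteq> S \<and> length xs = h i"
    "\<And>i j. i \<in> S \<Longrightarrow> j \<in> S \<Longrightarrow> i < j \<Longrightarrow> h i = h j \<Longrightarrow> w ! i \<le> w ! j"
    using ex_colouring[OF fin le] by metis
  define T where "T = {i\<in>S. h i = k}"
  have G: "incr_family w j (\<lambda>c. {i\<in>S. h i = c})" for j
    using S h(3) by (rule colour_classes_incr_family)
  have "card T \<le> max_pass (Suc k) [Suc (Suc k)..<Suc (Suc k + (d - Suc k))] (drop 0 w)"
  proof (rule card_incr_le_max_pass)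
    show "T \<subseteq> {0..<length w}" using S by (auto simp: T_def)
    show "weakly_incr_on w T"
      using G[of "Suc k"] unfolding incr_family_def T_def by blast
    fix i assume i: "i \<in> T"
    then obtain xs where xs: "decr_chain w (i # xs)" "set xs \<subseteq> S" "length xs = k"
      using h(2)[of i] by (auto simp: T_def)
    have "w ! x \<in> {1..<w ! i}" if "x \<in> set xs" for x
      using xs(1,2) letters[of x] that by (auto simp: decr_chain_Cons)
    then have "length xs \<le> card {1..<w ! i}"
      using xs(1) by (intro decr_chain_length_le[of w]) (simp_all add: decr_chain_Cons)
    then show "Suc k \<le> w ! i \<and> w ! i \<le> Suc k + (d - Suc k)"
      using xs(3) letters[of i] i k by (auto simp: T_def)
  qed simp
  moreover have "S = (\<Union>c<k. {i\<in>S. h i = c}) \<union> T"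
    using h(1) by (auto simp: T_def less_Suc_eq)
  then have "card S \<le> card (\<Union>c<k. {i\<in>S. h i = c}) + card T"
    by (metis card_Un_le)
  moreover have "card (\<Union>c<k. {i\<in>S. h i = c}) \<le> greene w k"
    using greene_ge[OF G] incr_family_card[OF G] by metis
  moreover have "greene w (Suc k) = card S"
    using F incr_family_card[OF F(1)] by (simp add: S_def del: sum.lessThan_Suc)
  ultimately show ?thesis
    using k by (simp del: upt_Suc)
qed

section \<open>Lower bound for a row by a first-passage number\<close>

text \<open>The length forces the chain to use each letter from \<open>hi\<close> down to
  \<open>lo + 1\<close> exactly once. Links inside a set \<open>B\<close> will replace stretches of
  a chain that leave \<open>B\<close>.\<close>

definition linked :: "nat list \<Rightarrow> nat set \<Rightarrow> nat \<Rightarrow> nat \<Rightarrow> bool" where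
  "linked w S lo hi \<longleftrightarrow> (\<exists>c. decr_chain w c \<and> set c \<subseteq> S \<and>
     (\<forall>i\<in>set c. lo < w ! i \<and> w ! i \<le> hi) \<and> length c = hi - lo)"

lemma linked_refl: "linked w S lo lo"
  unfolding linked_def by (intro exI[of _ "[]"]) simp

lemma linked_mono: "linked w S lo hi \<Longrightarrow> S \<subseteq> S' \<Longrightarrow> linked w S' lo hi"
  unfolding linked_def by blast

lemma linked_Suc:
  assumes "linked w S lo hi" "lo \<le> hi" "w ! t = Suc hi" "\<And>i. i \<in> S \<Longrightarrow> t < i"
  shows "linked w (insert t S) lo (Suc hi)"
proof -
  obtain c where c: "decr_chain w c" "set c \<subseteq> S" "length c = hi - lo"
    "\<forall>i\<in>set c. lo < w ! i \<and> w ! i \<le> hi"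
    using assms(1) by (auto simp: linked_def)
  then have "decr_chain w (t # c)"
    using assms(3,4) by (auto simp: decr_chain_Cons less_Suc_eq_le)
  then show ?thesis
    unfolding linked_def using c assms(2,3) by (intro exI[of _ "t # c"]) auto
qed

text \<open>A greedy hitting set: take every \<open>j\<close> outside \<open>B\<close> up to the first \<open>j\<close> in \<open>B\<close>, then every
  \<open>j - 1\<close> outside \<open>B\<close> up to the next \<open>j - 1\<close> in \<open>B\<close>, and so on. The letters of \<open>B\<close> at which
  the stages end supply the links.\<close>
lemma greedy_hitting_set:
  assumes "\<not> linked w (B \<inter> {s..<length w}) 0 (Suc j)" "s \<le> length w"
  shows "\<exists>X. X \<subseteq> {s..<length w} \<and> X \<inter> B = {} \<and> (\<forall>p\<in>X. w ! p \<le> Suc j) \<and>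
     min_pass (Suc j) (rev [1..<Suc j]) (drop s w) \<le> card X \<and>
     (\<forall>p\<in>X. linked w (B \<inter> {s..<p}) (w ! p) (Suc j)) \<and>
     (\<forall>p\<in>X. \<forall>p'\<in>X. p < p' \<longrightarrow> w ! p' < w ! p \<longrightarrow> linked w (B \<inter> {p<..<p'}) (w ! p') (w ! p))"
  using assms
proof (induction j arbitrary: s)
  case 0
  let ?X = "{p. s \<le> p \<and> p < length w \<and> w ! p = Suc 0}"
  have "p \<notin> B" if "p \<in> ?X" for p
  proof
    assume "p \<in> B"
    have "linked w {p} 0 (Suc 0)"
      using linked_Suc[OF linked_refl, of 0 w p "{}"] that by simp
    then have "linked w (B \<inter> {s..<length w}) 0 (Suc 0)"
      by (rule linked_mono) (use that \<open>p \<in> B\<close> in auto)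
    then show False
      using 0(1) by simp
  qed
  then have "?X \<inter> B = {}"
    by blast
  then show ?case
    using count_list_drop_take[of "length w" w s "Suc 0"]
    by (intro exI[of _ ?X]) (auto simp: linked_refl)
next
  case (Suc j)
  let ?l = "Suc (Suc j)"
  have lines: "rev [1..<?l] = Suc j # rev [1..<Suc j]"
    by simp
  define P where "P = {p\<in>B. s \<le> p \<and> p < length w \<and> w ! p = ?l}"
  show ?case
  proof (cases "P = {}")
    case True
    let ?X = "{p. s \<le> p \<and> p < length w \<and> w ! p = ?l}"
    have "min_pass ?l (rev [1..<?l]) (drop s w) \<le> card ?X"
      using min_pass_le_count[of ?l "rev [1..<?l]" "drop s w"]
        count_list_drop_take[of "length w" w s ?l] by simp
    moreover have "?X \<inter> B = {}"
      using True by (auto simp: P_def)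
    ultimately show ?thesis
      by (intro exI[of _ ?X]) (auto simp: linked_refl)
  next
    case False
    \<comment> \<open>The first \<open>?l\<close> in \<open>B\<close> ends the stage: the path
      switches there, and the lower letters are treated after \<open>t\<close>.\<close>
    define t where "t = Min P"
    have "finite P" by (rule finite_subset[of _ "{..<length w}"]) (auto simp: P_def)
    then have "t \<in> P" and t_le: "\<And>p. p \<in> P \<Longrightarrow> t \<le> p"
      using False by (auto simp: t_def)
    then have t: "t \<in> B" "s \<le> t" "t < length w" "w ! t = ?l"
      by (auto simp: P_def)
    define X1 where "X1 = {p. s \<le> p \<and> p < t \<and> w ! p = ?l}"
    have X1_B: "X1 \<inter> B = {}"
    proof (rule ccontr)
      assume "X1 \<inter> B \<noteq> {}"
      then obtain p where "p \<in> X1" "p \<in> B" by blast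
      then show False
        using t_le[of p] t(3) by (auto simp: X1_def P_def)
    qed
    \<comment> \<open>A full chain of lower letters in \<open>B\<close> after \<open>t\<close> would
      be completed by \<open>t\<close> to an excluded one.\<close>
    have "\<not> linked w (B \<inter> {Suc t..<length w}) 0 (Suc j)"
    proof
      assume "linked w (B \<inter> {Suc t..<length w}) 0 (Suc j)"
      from linked_Suc[OF this _ t(4)]
      have "linked w (insert t (B \<inter> {Suc t..<length w})) 0 ?l"
        by simp
      then have "linked w (B \<inter> {s..<length w}) 0 ?l"
        by (rule linked_mono) (use t in auto)
      with Suc.prems(1) show False ..
    qed
    from Suc.IH[OF this Suc_leI[OF t(3)]] obtain X2 where
      X2: "X2 \<subseteq> {Suc t..<length w}" "X2 \<inter> B = {}" "\<forall>p\<in>X2. w ! p \<le> Suc j"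
      "min_pass (Suc j) (rev [1..<Suc j]) (drop (Suc t) w) \<le> card X2"
      and pre: "\<forall>p\<in>X2. linked w (B \<inter> {Suc t..<p}) (w ! p) (Suc j)"
      and mid: "\<forall>p\<in>X2. \<forall>p'\<in>X2. p < p' \<longrightarrow> w ! p' < w ! p \<longrightarrow>
        linked w (B \<inter> {p<..<p'}) (w ! p') (w ! p)"
      by blast
    have pre': "linked w (B \<inter> {t..<p}) (w ! p) ?l" if "p \<in> X2" for p
    proof -
      have p: "t < p" "w ! p \<le> Suc j" "linked w (B \<inter> {Suc t..<p}) (w ! p) (Suc j)"
        using that X2(1,3) pre by auto
      have "linked w (insert t (B \<inter> {Suc t..<p})) (w ! p) ?l"
        using linked_Suc[OF p(3,2) t(4)] by simp
      then show ?thesis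
        by (rule linked_mono) (use p(1) t(1) in auto)
    qed
    let ?X = "X1 \<union> X2"
    have "card ?X = card X1 + card X2"
    proof (rule card_Un_disjoint)
      show "finite X1" "finite X2"
        using finite_subset[OF X2(1)] by (auto simp: X1_def)
      show "X1 \<inter> X2 = {}"
        using X2(1) by (auto simp: X1_def)
    qed
    moreover have "card X1 = count_list (take (t - s) (drop s w)) ?l"
      using count_list_drop_take[of t w s ?l] t(3) by (simp add: X1_def)
    moreover have "min_pass ?l (rev [1..<?l]) (drop s w)
        \<le> count_list (take (t - s) (drop s w)) ?l + min_pass (Suc j) (rev [1..<Suc j]) (drop t w)"
      unfolding lines
      by (subst drop_split[OF t(2)]) (rule min_pass_append_le)
    \<comment> \<open>Position \<open>t\<close> holds \<open>?l\<close>, not \<open>Suc j\<close>,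
      so passing over it costs the path nothing.\<close>
    moreover have "min_pass (Suc j) (rev [1..<Suc j]) (drop t w)
        \<le> min_pass (Suc j) (rev [1..<Suc j]) (drop (Suc t) w)"
      using min_pass_Cons_le[of "Suc j" "rev [1..<Suc j]" "w ! t" "drop (Suc t) w"] t(4)
        Cons_nth_drop_Suc[OF t(3)] by simp
    ultimately have card: "min_pass ?l (rev [1..<?l]) (drop s w) \<le> card ?X"
      using X2(4) by linarith
    have start: "linked w (B \<inter> {s..<p}) (w ! p) ?l" if "p \<in> ?X" for p
    proof (cases "p \<in> X1")
      case True
      then show ?thesis by (simp add: X1_def linked_refl)
    next
      case False
      with that have "linked w (B \<inter> {t..<p}) (w ! p) ?l"
        using pre' by blast
      then show ?thesis
        by (rule linked_mono) (use t(2) in auto)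
    qed
    have between: "linked w (B \<inter> {p<..<p'}) (w ! p') (w ! p)"
      if p: "p \<in> ?X" "p' \<in> ?X" "p < p'" "w ! p' < w ! p" for p p'
    proof (cases "p \<in> X2")
      case True
      then have "p' \<in> X2"
        using p X2(1) by (auto simp: X1_def)
      then show ?thesis
        using True mid p(3,4) by blast
    next
      case False
      then have "p \<in> X1" "p' \<in> X2"
        using p by (auto simp: X1_def)
      then have "linked w (B \<inter> {t..<p'}) (w ! p') (w ! p)"
        using pre' by (simp add: X1_def)
      then show ?thesis
        by (rule linked_mono) (use \<open>p \<in> X1\<close> in \<open>auto simp: X1_def\<close>)
    qed
    have "?X \<subseteq> {s..<length w}" "?X \<inter> B = {}" "\<forall>p\<in>?X. w ! p \<le> ?l"
      using X2(1-3) X1_B t by (auto simp: X1_def)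
    then show ?thesis
      using card start between by (intro exI[of _ ?X]) blast
  qed
qed

text \<open>\<open>B\<close> is the union of an optimal family and \<open>X\<close> is added
  greedily. In a chain of \<open>B \<union> X\<close>, the stretch from the first to the last
  element of \<open>X\<close> is replaced by a link inside \<open>B\<close>, at the loss of at most
  one element. Chains in \<open>B\<close> have length at most \<open>k\<close>, so those in
  \<open>B \<union> X\<close> have at most \<open>k + 1\<close>.\<close>

lemma greene_add_min_pass_le:
  "greene w k + min_pass (Suc k) (rev [1..<Suc k]) w \<le> greene w (Suc k)"
proof -
  obtain F where F: "incr_family w k F" "greene w k = (\<Sum>j<k. card (F j))"
    using greene_attained by blast
  define B where "B = (\<Union>j<k. F j)"
  have B: "B \<subseteq> {..<length w}"
    using incr_family_subset[OF F(1)] by (simp add: B_def)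
  have le: "length c \<le> k" if "decr_chain w c" "set c \<subseteq> B" for c
    using incr_family_decr_chain[OF F(1) that(1)] that(2) by (simp add: B_def)
  have "\<not> linked w (B \<inter> {0..<length w}) 0 (Suc k)"
    using le by (force simp: linked_def)
  from greedy_hitting_set[OF this] obtain X where
    X: "X \<subseteq> {0..<length w}" "X \<inter> B = {}"
    "min_pass (Suc k) (rev [1..<Suc k]) w \<le> card X"
    and between: "\<And>p p'. p \<in> X \<Longrightarrow> p' \<in> X \<Longrightarrow> p < p' \<Longrightarrow> w ! p' < w ! p \<Longrightarrow>
      linked w (B \<inter> {p<..<p'}) (w ! p') (w ! p)"
    by auto
  have "length xs \<le> Suc k" if xs: "decr_chain w xs" "set xs \<subseteq> B \<union> X" for xs
  proof (cases "\<exists>x\<in>set xs. x \<in> X")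
    case False
    then have "set xs \<subseteq> B" using xs(2) by auto
    then show ?thesis using le[OF xs(1)] by simp
  next
    case True
    then obtain ys p zs where 1: "xs = ys @ p # zs" "p \<in> X" "\<forall>y\<in>set ys. y \<notin> X"
      by (rule split_list_first_propE)
    show ?thesis
    proof (cases "\<exists>x\<in>set zs. x \<in> X")
      \<comment> \<open>Here \<open>p\<close> is the only element of \<open>X\<close>; deleting it
        leaves a chain in \<open>B\<close>.\<close>
      case False
      then have "set (ys @ zs) \<subseteq> B"
        using xs(2) 1 by auto
      moreover have "decr_chain w (ys @ zs)"
        using xs(1) 1(1) by (auto simp: decr_chain_append decr_chain_Cons)
      ultimately show ?thesis
        using le[of "ys @ zs"] 1(1) by simp
    next
      case True
      then obtain ms p' us where 2: "zs = ms @ p' # us" "p' \<in> X" "\<forall>y\<in>set us. y \<notin> X"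
        by (rule split_list_last_propE)
      have xs_eq: "xs = ys @ p # ms @ p' # us"
        using 1(1) 2(1) by simp
      note chain = xs(1)[unfolded xs_eq decr_chain_append decr_chain_Cons]
      have pp': "p < p'" "w ! p' < w ! p"
        using chain by auto
      obtain c where c: "decr_chain w c" "set c \<subseteq> B \<inter> {p<..<p'}"
        "\<forall>i\<in>set c. w ! p' < w ! i \<and> w ! i \<le> w ! p" "length c = w ! p - w ! p'"
        using between[OF 1(2) 2(2) pp'] by (auto simp: linked_def)
      \<comment> \<open>The letters of \<open>ms\<close> lie strictly between those of
        \<open>p'\<close> and \<open>p\<close>, so \<open>p # ms @ [p']\<close> is at most one
        longer than \<open>c\<close>.\<close>
      have "length ms \<le> card {w ! p'<..<w ! p}"
        using chain by (intro decr_chain_length_le[of w]) auto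
      moreover have "length (ys @ c @ us) \<le> k"
      proof (rule le)
        have "y < i \<and> w ! i < w ! y" if "y \<in> set ys" "i \<in> set c" for y i
          using chain c(2,3) that by fastforce
        moreover have "i < u \<and> w ! u < w ! i" if "u \<in> set us" "i \<in> set c" for u i
          using chain c(2,3) that by fastforce
        ultimately show "decr_chain w (ys @ c @ us)"
          using chain c(1) by (auto simp: decr_chain_append)
        show "set (ys @ c @ us) \<subseteq> B"
          using xs(2) 1(3) 2(3) c(2) unfolding xs_eq by auto
      qed
      ultimately show ?thesis
        using c(4) pp'(2) by (simp add: xs_eq)
    qed
  qed
  then have "card (B \<union> X) \<le> greene w (Suc k)"
    using B X(1) by (intro card_le_greene) auto
  moreover have "card (B \<union> X) = card B + card X"
    using finite_subset[OF B] finite_subset[OF X(1)] X(2) by (intro card_Un_disjoint) auto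
  moreover have "card B = greene w k"
    using F incr_family_card[OF F(1)] by (simp add: B_def)
  ultimately show ?thesis
    using X(3) by linarith
qed

section \<open>The rows of the shape\<close>

text \<open>Monotonicity in \<open>k\<close> makes the truncated subtraction in \<open>shRSK\<close>
  exact.\<close>

lemma real_shRSK: "real (shRSK w (Suc k)) = real (greene w (Suc k)) - real (greene w k)"
  using greene_mono_k[of w k] by (simp add: shRSK_def)

lemma shRSK_change_letter:
  "\<bar>real (shRSK (u @ z # v) (Suc k)) - real (shRSK (u @ z' # v) (Suc k))\<bar> \<le> 2"
  using greene_change_letter[of u z v "Suc k" z'] greene_change_letter[of u z' v "Suc k" z]
    greene_change_letter[of u z v k z'] greene_change_letter[of u z' v k z]
  by (simp add: real_shRSK)

lemma shRSK_mean_square_le: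
  fixes \<alpha> :: "nat \<Rightarrow> real"
  assumes nonneg: "\<And>i. i \<in> {1..d} \<Longrightarrow> \<alpha> i \<ge> 0"
    and sum1: "(\<Sum>i=1..d. \<alpha> i) = 1"
    and anti: "\<And>i j. 1 \<le> i \<Longrightarrow> i \<le> j \<Longrightarrow> j \<le> d \<Longrightarrow> \<alpha> j \<le> \<alpha> i"
    and n: "n \<ge> 1" and k: "k \<in> {1..d}"
  shows "word_exp {1..d} \<alpha> n (\<lambda>w. (real (shRSK w k) - real n * \<alpha> k)\<^sup>2) \<le> 13 * real n"
proof -
  obtain m where m: "k = Suc m" "Suc m \<le> d"
    using k by (cases k) auto
  define E where "E f = word_exp {1..d} \<alpha> n f" for f :: "nat list \<Rightarrow> real"
  define c where "c = real n * \<alpha> k"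
  \<comment> \<open>This balances \<open>r * real n\<close> against \<open>1 / r\<close>: both equal
    \<open>sqrt (real n)\<close>, and the bias is at most three such terms.\<close>
  define r where "r = 1 / sqrt (real n)"
  let ?X = "\<lambda>w. real (shRSK w k)"
  have r: "0 < r" "r \<le> 1"
    using n by (auto simp: r_def)
  have rn: "r * real n = sqrt (real n)" "1 / r = sqrt (real n)"
    using n by (auto simp: r_def real_div_sqrt)
  have "E ?X \<le> E (\<lambda>w. real (max_pass k [Suc k..<Suc d] w))"
    unfolding E_def using nonneg
  proof (rule word_exp_mono)
    fix w :: "nat list" assume "set w \<subseteq> {1..d}"
    from greene_Suc_le_max_pass[OF this m(2)]
    show "?X w \<le> real (max_pass k [Suc k..<Suc d] w)"
      unfolding m(1) real_shRSK by linarith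
  qed
  also have "\<dots> \<le> c + 2 * r * real n + 1 / r"
    unfolding E_def c_def by (rule max_pass_mean_le) (use nonneg sum1 anti k r in auto)
  finally have upper: "E ?X - c \<le> 3 * sqrt (real n)"
    using rn by (simp add: mult.assoc)
  have "c - r * real n - 1 / r \<le> E (\<lambda>w. real (min_pass k (rev [1..<k]) w))"
    unfolding E_def c_def by (rule min_pass_mean_ge) (use nonneg sum1 anti k r in auto)
  also have "\<dots> \<le> E ?X"
    unfolding E_def using nonneg
  proof (rule word_exp_mono)
    fix w :: "nat list"
    from greene_add_min_pass_le[of w m]
    show "real (min_pass k (rev [1..<k]) w) \<le> ?X w"
      unfolding m(1) real_shRSK by linarith
  qed
  finally have "\<bar>E ?X - c\<bar> \<le> 3 * sqrt (real n)"
    using upper rn real_sqrt_ge_zero[of "real n"] by linarith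
  then have "(E ?X - c)\<^sup>2 \<le> (3 * sqrt (real n))\<^sup>2"
    by (metis abs_ge_zero power2_abs power_mono)
  then have bias: "(E ?X - c)\<^sup>2 \<le> 9 * real n"
    by (simp add: power_mult_distrib)
  \<comment> \<open>One letter moves a row by at most 2, so the variance is at most
    \<open>4 * real n\<close>; with the squared bias \<open>9 * real n\<close> this makes
    13.\<close>
  have "E (\<lambda>w. (?X w)\<^sup>2) - (E ?X)\<^sup>2 \<le> 2\<^sup>2 * real n"
    unfolding E_def
    by (rule word_exp_variance_le) (use nonneg sum1 shRSK_change_letter in \<open>auto simp: m(1)\<close>)
  moreover have "E (\<lambda>w. (?X w - c)\<^sup>2) = E (\<lambda>w. (?X w)\<^sup>2) - 2 * c * E ?X + c\<^sup>2"
  proof -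
    have "(\<lambda>w. (?X w - c)\<^sup>2) = (\<lambda>w. (?X w)\<^sup>2 - 2 * c * ?X w + c\<^sup>2)"
      by (auto simp: power2_diff)
    then show ?thesis
      using word_exp_const[OF sum1]
      by (simp only: E_def word_exp_add word_exp_diff word_exp_cmult)
  qed
  moreover have "(E ?X - c)\<^sup>2 = (E ?X)\<^sup>2 - 2 * c * E ?X + c\<^sup>2"
    by (simp add: power2_diff)
  ultimately have "E (\<lambda>w. (?X w - c)\<^sup>2) \<le> 13 * real n"
    using bias by simp
  then show ?thesis
    by (simp only: E_def c_def)
qed

theorem mainTheorem4:
  fixes \<alpha> :: "nat \<Rightarrow> real" and d n k :: nat
  assumes "\<And>i. i \<in> {1..d} \<Longrightarrow> \<alpha> i \<ge> 0"
    and "(\<Sum>i=1..d. \<alpha> i) = 1"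
    and "\<And>i j. 1 \<le> i \<Longrightarrow> i \<le> j \<Longrightarrow> j \<le> d \<Longrightarrow> \<alpha> j \<le> \<alpha> i"
    and "n \<ge> 1"
    and "1 \<le> k" and "k \<le> d"
  shows "(\<Sum>w\<in>words d n. word_prob \<alpha> w *
            (\<Sum>i=1..k. (real (shRSK w i) / real n - \<alpha> i)^2))
         \<le> 46 * real k / real n"
proof -
  let ?E = "word_exp {1..d} \<alpha> n"
  have "(\<Sum>w\<in>words d n. word_prob \<alpha> w * (\<Sum>i=1..k. (real (shRSK w i) / real n - \<alpha> i)^2))
      = (\<Sum>i=1..k. \<Sum>w\<in>words d n. word_prob \<alpha> w * (real (shRSK w i) / real n - \<alpha> i)^2)"
    by (simp only: sum_distrib_left sum.swap[of _ "{1..k}"])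
  also have "\<dots> = (\<Sum>i=1..k. ?E (\<lambda>w. (real (shRSK w i) / real n - \<alpha> i)^2))"
    by (simp only: sum_words_eq_word_exp)
  also have "\<dots> \<le> (\<Sum>i=1..k. 46 / real n)"
  proof (rule sum_mono)
    fix i assume "i \<in> {1..k}"
    then have i: "i \<in> {1..d}" using assms(6) by auto
    have "(real (shRSK w i) / real n - \<alpha> i)^2
        = 1 / (real n)\<^sup>2 * (real (shRSK w i) - real n * \<alpha> i)\<^sup>2" for w
      using assms(4) by (simp add: field_simps power2_eq_square)
    then have "?E (\<lambda>w. (real (shRSK w i) / real n - \<alpha> i)^2)
        = 1 / (real n)\<^sup>2 * ?E (\<lambda>w. (real (shRSK w i) - real n * \<alpha> i)\<^sup>2)"
      by (simp only: word_exp_cmult)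
    also have "\<dots> \<le> 1 / (real n)\<^sup>2 * (46 * real n)"
      using shRSK_mean_square_le[OF assms(1-4) i] by (intro mult_left_mono) auto
    also have "\<dots> = 46 / real n"
      by (simp add: power2_eq_square)
    finally show "?E (\<lambda>w. (real (shRSK w i) / real n - \<alpha> i)^2) \<le> 46 / real n" .
  qed
  finally show ?thesis
    by (simp add: mult.commute)
qed

end
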